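(* Let $Q\in\mathbb{F}_q[T]$ be nonzero, let $a\in\mathbb{C}$, let $y\in\mathbb{C}$ with $|y|\le 1$, and let $s\in\mathbb{C}$ satisfy $\min\{\mathrm{Re}(s),\mathrm{Re}(s-a),\mathrm{Re}(s-2a),\mathrm{Re}(2s-2a)\}>1$. Then \[\sum_{f\text{ monic}}\frac{y^{\Omega(f)}}{|f|^s}\,\mathbb{V}[\sigma_a(f;\circ,Q)]=\frac{1}{\Phi(Q)^2}\,\frac{\zeta_A(s,y)\,L(s-2a,\chi_0,y)}{L(2s-2a,\chi_0,y^2)}\sum_{\chi\neq\chi_0}L(s-a,\chi,y)\,L(s-a,\overline{\chi},y).\]
   Context: $q$ is a prime power, $|f|=q^{\deg f}$, $\Omega(f)$ is the number of monic irreducible factors of $f$ with multiplicity. $\Phi(Q)$ is the number of units of $\mathbb{F}_q[T]/(Q)$; Dirichlet characters $\chi$ modulo $Q$ are extended by $0$ on polynomials not coprime to $Q$; $\chi_0$ is the principal character and the sum is over non-principal characters mod $Q$. $P$ runs over monic irreducibles. Define $\zeta_A(s,y)=\prod_P(1-y|P|^{-s})^{-1}$ and $L(s,\chi,y)=\prod_P(1-y\chi(P)|P|^{-s})^{-1}$. For monic $f$: $\sigma_a(f;Q)=\sum_{d\mid f,\,d\text{ monic},\,\gcd(d,Q)=1}|d|^a$, $\sigma_a(f;h,Q)=\sum_{d\mid f,\,d\text{ monic},\,d\equiv h\bmod Q}|d|^a$, and \[\mathbb{V}[\sigma_a(f;\circ,Q)]=\frac{1}{\Phi(Q)}\sum_{h}\left(\sigma_a(f;h,Q)-\frac{\sigma_a(f;Q)}{\Phi(Q)}\right)^2,\]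 with $h$ over a set of representatives of the reduced residue classes mod $Q$. *)

theory Defs
  imports "HOL-Analysis.Analysis" "HOL-Number_Theory.Cong"
begin

text \<open>
  Throughout, \<open>\<bbbF>\<^sub>q\<close> is an arbitrary finite field, given by a type \<open>'a :: {field, finite}\<close>, so that
  \<open>q = CARD('a)\<close> and \<open>\<bbbF>\<^sub>q[T]\<close> is the type \<open>'a poly\<close>.
\<close>

abbreviation monic :: "'a::{field,finite} poly \<Rightarrow> bool" where
  "monic f \<equiv> lead_coeff f = 1"

text \<open>Only meaningful for \<open>f \<noteq> 0\<close> (at \<open>0\<close> the value is \<open>1\<close>); it is used only for monic \<open>f\<close>.\<close>

definition pabs :: "'a::{field,finite} poly \<Rightarrow> nat" where
  "pabs f = CARD('a) ^ degree f"

definition monic_irreducibles :: "'a::{field,finite} poly set" where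
  "monic_irreducibles = {P. monic P \<and> irreducible P}"

text \<open>
  The inner maximum is the multiplicity of \<open>P\<close> in \<open>f\<close>; the library constant
  \<^verbatim>\<open>multiplicity\<close> is not available on \<open>'a poly\<close> when \<open>'a\<close> is merely of class \<^class>\<open>field\<close>.
\<close>

definition big_Omega :: "'a::{field,finite} poly \<Rightarrow> nat" where
  "big_Omega f = (\<Sum>P | P \<in> monic_irreducibles \<and> P dvd f. Max {n. P ^ n dvd f})"

text \<open>
  The units of \<open>\<bbbF>\<^sub>q[T]/(Q)\<close>, each residue class being represented by its element that is reduced
  modulo \<open>Q\<close>. If \<open>Q\<close> is a nonzero constant, the quotient is the zero ring, whose only element is
  a unit; accordingly the set is then \<open>{0}\<close>.
\<close>

definition reduced_residues :: "'a::{field,finite} poly \<Rightarrow> 'a poly set" where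
  "reduced_residues Q = {h. h mod Q = h \<and> (\<exists>g. [h * g = 1] (mod Q))}"

definition Phi :: "'a::{field,finite} poly \<Rightarrow> nat" where
  "Phi Q = card (reduced_residues Q)"

text \<open>
  A homomorphism from the units of \<open>\<bbbF>\<^sub>q[T]/(Q)\<close> to \<open>\<complex> - {0}\<close>, viewed as a function
  on polynomials and extended by \<open>0\<close> to those not coprime to \<open>Q\<close>.
\<close>

definition dirichlet_char :: "'a::{field,finite} poly \<Rightarrow> ('a poly \<Rightarrow> complex) \<Rightarrow> bool" where
  "dirichlet_char Q chi \<longleftrightarrow>
     (\<forall>f g. [f = g] (mod Q) \<longrightarrow> chi f = chi g) \<and>
     (\<forall>f g. chi (f * g) = chi f * chi g) \<and>
     (\<forall>f. chi f \<noteq> 0 \<longleftrightarrow> coprime f Q)"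

definition principal_char :: "'a::{field,finite} poly \<Rightarrow> 'a poly \<Rightarrow> complex" where
  "principal_char Q f = (if coprime f Q then 1 else 0)"

text \<open>
  Unconditional (order-independent) product over a possibly infinite index set: the limit of
  the finite subproducts, as in \<^const>\<open>infsum\<close>. The value is unspecified if there is no limit.
\<close>

definition infprod :: "('b \<Rightarrow> complex) \<Rightarrow> 'b set \<Rightarrow> complex" where
  "infprod f A = Lim (finite_subsets_at_top A) (prod f)"

definition zeta_A :: "'a::{field,finite} itself \<Rightarrow> complex \<Rightarrow> complex \<Rightarrow> complex" where
  "zeta_A _ s y =
     infprod (\<lambda>P :: 'a poly. inverse (1 - y * of_nat (pabs P) powr (-s))) monic_irreducibles"

definition L_fun ::
  "complex \<Rightarrow> ('a::{field,finite} poly \<Rightarrow> complex) \<Rightarrow> complex \<Rightarrow> complex" where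
  "L_fun s chi y =
     infprod (\<lambda>P. inverse (1 - y * chi P * of_nat (pabs P) powr (-s))) monic_irreducibles"

definition sigma_coprime :: "complex \<Rightarrow> 'a::{field,finite} poly \<Rightarrow> 'a poly \<Rightarrow> complex" where
  "sigma_coprime a f Q = (\<Sum>d | d dvd f \<and> monic d \<and> coprime d Q. of_nat (pabs d) powr a)"

definition sigma_residue ::
  "complex \<Rightarrow> 'a::{field,finite} poly \<Rightarrow> 'a poly \<Rightarrow> 'a poly \<Rightarrow> complex" where
  "sigma_residue a f h Q = (\<Sum>d | d dvd f \<and> monic d \<and> [d = h] (mod Q). of_nat (pabs d) powr a)"

text \<open>
  The square is the square of a complex number, not of its absolute value. The choice of
  representatives \<open>h\<close> is immaterial, see \<open>variance_sigma_representatives\<close> below.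
\<close>

definition variance_sigma :: "complex \<Rightarrow> 'a::{field,finite} poly \<Rightarrow> 'a poly \<Rightarrow> complex" where
  "variance_sigma a f Q =
     1 / of_nat (Phi Q) *
     (\<Sum>h\<in>reduced_residues Q. (sigma_residue a f h Q - sigma_coprime a f Q / of_nat (Phi Q))\<^sup>2)"

lemma variance_sigma_representatives:
  assumes "bij_betw (\<lambda>h. h mod Q) H (reduced_residues Q)"
  shows "variance_sigma a f Q =
     1 / of_nat (Phi Q) *
     (\<Sum>h\<in>H. (sigma_residue a f h Q - sigma_coprime a f Q / of_nat (Phi Q))\<^sup>2)"
proof -
  have "sigma_residue a f (h mod Q) Q = sigma_residue a f h Q" for h
    by (simp add: sigma_residue_def cong_def)
  then show ?thesis
    by (simp add: variance_sigma_def flip: sum.reindex_bij_betw[OF assms])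
qed

end

theory Submission
  imports Defs "HOL-Computational_Algebra.Polynomial_Factorial" "HOL-Algebra.Group"
begin

text \<open>
  By orthogonality of Dirichlet characters, the variance is \<open>\<Phi>(Q)\<^sup>-\<^sup>2\<close> times the sum of
  \<open>\<sigma>(f, \<chi>) \<sigma>(f, \<chi>')\<close> over \<open>\<chi> \<noteq> \<chi>\<^sub>0\<close>, where \<open>\<chi>'\<close> is the conjugate of \<open>\<chi>\<close> and
  \<open>\<sigma>(f, \<chi>)\<close> is the sum of \<open>\<chi>(d) |d|\<^sup>a\<close> over \<open>d | f\<close>. The resulting series are evaluated by
  Ramanujan's identity for \<open>\<Sum> g(f) (\<Sum>d|f. u(d)) (\<Sum>e|f. v(e))\<close> with \<open>g\<close>, \<open>u\<close>, \<open>v\<close> completely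
  multiplicative: writing a pair of divisors of \<open>f\<close> as \<open>(k d, k e)\<close> with \<open>d\<close>, \<open>e\<close> coprime, \<open>f\<close>
  becomes \<open>m k d e\<close>, so the series factors into \<open>D(g) D(u v g)\<close> times the sum of
  \<open>u(d) g(d) v(e) g(e)\<close> over coprime pairs. Pulling out the gcd in the same way without the
  condition on \<open>f\<close> shows that the latter is \<open>D(u g) D(v g) / D(u v g\<^sup>2)\<close>.
\<close>

section \<open>Polynomials over a finite field\<close>

text \<open>Division with remainder: a nonzero element \<open>d\<close> of least degree in the ideal
  \<open>I\<close> generated by \<open>p\<close> and \<open>q\<close> divides all of
  \<open>I\<close>, because a nonzero remainder modulo \<open>d\<close> would lie in
  \<open>I\<close> and have smaller degree. Hence \<open>d\<close> is a common divisor of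
  \<open>p\<close> and \<open>q\<close>, so a unit.\<close>

lemma poly_bezout:
  fixes p q :: "'a::field poly"
  assumes "coprime p q"
  obtains u v where "u * p + v * q = 1"
proof -
  define I where "I = {u * p + v * q | u v. True}"
  have comb: "a * x + b * y \<in> I" if "x \<in> I" "y \<in> I" for a b x y
  proof -
    from that obtain u v u' v' where "x = u * p + v * q" "y = u' * p + v' * q"
      unfolding I_def by blast
    then have "a * x + b * y = (a * u + b * u') * p + (a * v + b * v') * q" by (simp add: algebra_simps)
    then show ?thesis unfolding I_def by blast
  qed
  have "p = 1 * p + 0 * q" "q = 0 * p + 1 * q" by simp_all
  then have pI: "p \<in> I" "q \<in> I"
    unfolding I_def by blast+
  have "p \<noteq> 0 \<or> q \<noteq> 0" using assms by auto
  with pI have "\<exists>x. x \<in> I \<and> x \<noteq> 0" by blast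
  then obtain d where d: "d \<in> I" "d \<noteq> 0" and least: "\<And>x. x \<in> I \<and> x \<noteq> 0 \<Longrightarrow> degree d \<le> degree x"
    using ex_has_least_nat[of "\<lambda>x. x \<in> I \<and> x \<noteq> 0" _ degree] by auto
  have dvd: "d dvd x" if "x \<in> I" for x
  proof (rule ccontr)
    assume nd: "\<not> d dvd x"
    have "x mod d = 1 * x + (- (x div d)) * d" by (simp add: minus_div_mult_eq_mod)
    then have "x mod d \<in> I" using comb[OF that d(1), of 1 "- (x div d)"] by simp
    moreover have "x mod d \<noteq> 0" using nd by (simp add: dvd_eq_mod_eq_0)
    ultimately show False
      using least[of "x mod d"] degree_mod_less'[OF d(2), of x] by (simp add: not_le[symmetric])
  qed
  have "is_unit d" using assms dvd pI by (meson coprime_common_divisor)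
  then obtain e where e: "1 = e * d" by (metis dvdE mult.commute)
  from d(1) obtain u v where "d = u * p + v * q" unfolding I_def by blast
  with e have "(e * u) * p + (e * v) * q = 1" by (simp add: algebra_simps)
  with that show ?thesis by blast
qed

lemma poly_coprime_dvd_mult:
  fixes a b c :: "'a::field poly"
  assumes "coprime a b" "a dvd b * c"
  shows "a dvd c"
proof -
  obtain u v where uv: "u * a + v * b = 1" using poly_bezout[OF assms(1)] .
  have "c = (u * a + v * b) * c" by (simp add: uv)
  also have "\<dots> = a * (u * c) + v * (b * c)" by (simp add: algebra_simps)
  also have "a dvd \<dots>" using assms(2) by simp
  finally show ?thesis .
qed

lemma poly_coprime_mult_dvd:
  fixes a b c :: "'a::field poly"
  assumes "coprime a b" "a dvd c" "b dvd c"
  shows "a * b dvd c"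
proof -
  obtain x where x: "c = a * x" using assms(2) ..
  have "coprime b a" using assms(1) by (rule coprime_commute[THEN iffD1])
  moreover have "b dvd a * x" using assms(3) x by simp
  ultimately have "b dvd x" by (rule poly_coprime_dvd_mult)
  with x show ?thesis by simp
qed

text \<open>The product of the Bezout relations for \<open>a\<close> and for \<open>b\<close> is a
  Bezout relation for \<open>a * b\<close>.\<close>

lemma poly_coprime_mult_left_iff:
  fixes a b c :: "'a::field poly"
  shows "coprime (a * b) c \<longleftrightarrow> coprime a c \<and> coprime b c"
proof
  assume "coprime a c \<and> coprime b c"
  then obtain u v u' v' where "u * a + v * c = 1" "u' * b + v' * c = 1"
    using poly_bezout by metis
  then have "(u * a + v * c) * (u' * b + v' * c) = 1" by simp
  then have eq: "(u * u') * (a * b) + (u * a * v' + v * u' * b + v * c * v') * c = 1"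
    by (simp add: algebra_simps)
  show "coprime (a * b) c"
  proof (rule coprimeI)
    fix d assume d: "d dvd a * b" "d dvd c"
    have "d dvd (u * u') * (a * b) + (u * a * v' + v * u' * b + v * c * v') * c"
      by (rule dvd_add; rule dvd_mult; fact d)
    with eq show "is_unit d" by simp
  qed
next
  assume c: "coprime (a * b) c"
  show "coprime a c \<and> coprime b c"
    using coprime_divisors[OF _ dvd_refl c, of a] coprime_divisors[OF _ dvd_refl c, of b] by simp
qed

text \<open>A Bezout relation read modulo \<open>Q\<close> exhibits an inverse of \<open>f\<close>.
  This connects \<open>reduced_residues\<close>, defined by invertibility, with the coprimality
  condition in \<open>dirichlet_char\<close>.\<close>

lemma poly_coprime_iff_invertible:
  fixes f Q :: "'a::field poly"
  shows "coprime f Q \<longleftrightarrow> (\<exists>g. [f * g = 1] (mod Q))"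
proof
  assume "coprime f Q"
  then obtain u v where "u * f + v * Q = 1" using poly_bezout by blast
  then have "1 = f * u + v * Q" by (simp add: mult.commute)
  then have "(f * u) mod Q = 1 mod Q" by (metis mod_mult_self1)
  then show "\<exists>g. [f * g = 1] (mod Q)" by (auto simp: cong_def)
next
  assume "\<exists>g. [f * g = 1] (mod Q)"
  then obtain g where g: "(f * g) mod Q = 1 mod Q" by (auto simp: cong_def)
  show "coprime f Q"
  proof (rule coprimeI)
    fix d assume d: "d dvd f" "d dvd Q"
    then have "d dvd (f * g) mod Q" by (simp add: dvd_mod)
    with g d show "is_unit d" by (simp add: dvd_mod_iff)
  qed
qed

lemma poly_coprime_cong:
  fixes f g Q :: "'a::field poly"
  assumes "[f = g] (mod Q)"
  shows "coprime f Q \<longleftrightarrow> coprime g Q"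
  unfolding poly_coprime_iff_invertible
  using assms by (meson cong_scalar_right cong_sym cong_trans)

section \<open>Monic polynomials and their divisors\<close>

lemma monic_mult: "monic f \<Longrightarrow> monic g \<Longrightarrow> monic (f * g)"
  by (simp add: lead_coeff_mult)

lemma monic_mult_cancel: "monic (f * g) \<Longrightarrow> monic f \<Longrightarrow> monic g"
  by (simp add: lead_coeff_mult)

lemma monic_degree_0: "monic f \<Longrightarrow> degree f = 0 \<Longrightarrow> f = 1"
  by (erule degree_eq_zeroE) (simp add: one_pCons)

text \<open>Equal degrees leave only a constant cofactor, and a monic constant is
  \<open>1\<close>.\<close>

lemma monic_dvd_antisym:
  assumes "monic f" "monic g" "f dvd g" "g dvd f"
  shows "f = g"
proof -
  obtain c where c: "g = f * c" using assms(3) ..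
  have nz: "f \<noteq> 0" "g \<noteq> 0" using assms by auto
  then have "degree f = degree g"
    using assms by (simp add: dvd_imp_degree_le eq_iff)
  then have "degree c = 0" using c nz by (simp add: degree_mult_eq)
  moreover have "monic c" using c assms monic_mult_cancel by blast
  ultimately show ?thesis using c monic_degree_0 by force
qed

lemma finite_degree_le: "finite {p :: 'a::{zero,finite} poly. degree p \<le> n}"
proof (induction n)
  case 0
  have "{p :: 'a poly. degree p \<le> 0} \<subseteq> range (\<lambda>c. [:c:])"
    by (auto elim!: degree_eq_zeroE)
  then show ?case by (rule finite_subset) simp
next
  case (Suc n)
  have "{p :: 'a poly. degree p \<le> Suc n} \<subseteq> (\<lambda>(c, p). pCons c p) ` (UNIV \<times> {p. degree p \<le> n})"
  proof
    fix p :: "'a poly" assume "p \<in> {p. degree p \<le> Suc n}"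
    moreover obtain c r where "p = pCons c r" by (cases p)
    ultimately show "p \<in> (\<lambda>(c, p). pCons c p) ` (UNIV \<times> {p. degree p \<le> n})"
      by (auto simp: image_iff split: if_splits)
  qed
  then show ?case by (rule finite_subset) (simp add: Suc)
qed

lemma finite_monic_degree: "finite {f :: 'a::{field,finite} poly. monic f \<and> degree f = n}"
  by (rule finite_subset[OF _ finite_degree_le[of n]]) auto

text \<open>Dropping the constant coefficient turns a monic polynomial of degree
  \<open>Suc n\<close> into one of degree \<open>n\<close>. An upper bound is all that the
  convergence proof asks for.\<close>

lemma card_monic_degree_le: "card {f :: 'a::{field,finite} poly. monic f \<and> degree f = n} \<le> CARD('a) ^ n"
proof (induction n)
  case 0
  have "{f :: 'a poly. monic f \<and> degree f = 0} \<subseteq> {1}"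
    by (auto elim!: degree_eq_zeroE simp: one_pCons)
  then show ?case using card_mono[of "{1 :: 'a poly}"] by fastforce
next
  case (Suc n)
  let ?M = "\<lambda>n. {f :: 'a poly. monic f \<and> degree f = n}"
  have "?M (Suc n) \<subseteq> (\<lambda>(c, p). pCons c p) ` (UNIV \<times> ?M n)"
  proof
    fix p assume p: "p \<in> ?M (Suc n)"
    obtain c r where "p = pCons c r" by (cases p)
    with p show "p \<in> (\<lambda>(c, p). pCons c p) ` (UNIV \<times> ?M n)"
      by (auto simp: image_iff split: if_splits)
  qed
  then have "card (?M (Suc n)) \<le> card ((UNIV :: 'a set) \<times> ?M n)"
    by (intro surj_card_le finite_cartesian_product finite_monic_degree) auto
  also have "\<dots> \<le> CARD('a) * CARD('a) ^ n"
    using Suc by (simp add: card_cartesian_product)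
  finally show ?case by simp
qed

lemma finite_monic_divisors:
  fixes f :: "'a::{field,finite} poly"
  assumes "f \<noteq> 0"
  shows "finite {d. d dvd f \<and> monic d}"
  by (rule finite_subset[OF _ finite_degree_le[of "degree f"]]) (auto simp: dvd_imp_degree_le assms)

text \<open>Among the monic divisors other than \<open>1\<close>, one of least degree is
  irreducible.\<close>

lemma exists_monic_irreducible_dvd:
  fixes f :: "'a::{field,finite} poly"
  assumes "monic f" "f \<noteq> 1"
  obtains P where "P \<in> monic_irreducibles" "P dvd f"
proof -
  let ?D = "\<lambda>p. p dvd f \<and> monic p \<and> p \<noteq> 1"
  obtain P where P: "?D P" and least: "\<And>p. ?D p \<Longrightarrow> degree P \<le> degree p"
    using ex_has_least_nat[of ?D f degree] assms by auto
  have "irreducible P"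
  proof (rule irreducibleI)
    show "P \<noteq> 0" using P by auto
    show "\<not> is_unit P"
    proof
      assume "is_unit P"
      with \<open>P \<noteq> 0\<close> have "degree P = 0" by (simp add: is_unit_iff_degree)
      with P monic_degree_0[of P] show False by simp
    qed
    fix a b assume ab: "P = a * b"
    with P have nz: "a \<noteq> 0" "b \<noteq> 0" by auto
    \<comment> \<open>Made monic, the factor \<open>a\<close> competes with \<open>P\<close> for the
      least degree.\<close>
    define a' where "a' = smult (inverse (lead_coeff a)) a"
    have a': "monic a'" "degree a' = degree a" using nz by (auto simp: a'_def)
    have "a' dvd P" using ab nz by (auto simp: a'_def smult_dvd_iff)
    show "is_unit a \<or> is_unit b"
    proof (cases "a' = 1")
      case True
      then have "degree a = 0" using a' by simp
      then show ?thesis using nz by (simp add: is_unit_iff_degree)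
    next
      case False
      then have "degree P \<le> degree a" using least[of a'] a' \<open>a' dvd P\<close> P dvd_trans by metis
      then show ?thesis using ab nz by (simp add: is_unit_iff_degree degree_mult_eq)
    qed
  qed
  with P that show ?thesis by (auto simp: monic_irreducibles_def)
qed

lemma monic_irreducible_prime_elem: "P \<in> monic_irreducibles \<Longrightarrow> prime_elem P"
  by (simp add: monic_irreducibles_def field_poly_irreducible_imp_prime)

lemma monic_irreducible_degree_pos: "P \<in> monic_irreducibles \<Longrightarrow> degree P > 0"
  by (auto simp: monic_irreducibles_def irreducible_def is_unit_iff_degree)

lemma monic_irreducible_dvd_eq:
  assumes "P \<in> monic_irreducibles" "R \<in> monic_irreducibles" "P dvd R"
  shows "P = R"
proof -
  have "\<not> is_unit P" "R dvd P \<or> is_unit P"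
    using assms irreducibleD'[of R P] by (auto simp: monic_irreducibles_def irreducible_def)
  with assms show ?thesis
    by (auto simp: monic_irreducibles_def intro: monic_dvd_antisym)
qed

text \<open>\<open>k\<close> is a monic common divisor of largest degree, that is, the monic gcd. A
  nonconstant common divisor of the cofactors, made monic, would give a larger one.\<close>

lemma monic_common_factor:
  fixes d e :: "'a::{field,finite} poly"
  assumes "monic d" "monic e"
  obtains k d' e' where "monic k" "monic d'" "monic e'" "coprime d' e'" "d = k * d'" "e = k * e'"
proof -
  let ?D = "\<lambda>p. p dvd d \<and> p dvd e \<and> monic p"
  have "\<forall>p. ?D p \<longrightarrow> degree p \<le> degree d" using assms by (auto intro: dvd_imp_degree_le)
  then obtain k where k: "?D k" and greatest: "\<And>p. ?D p \<Longrightarrow> degree p \<le> degree k"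
    using ex_has_greatest_nat[of ?D 1 degree "Suc (degree d)"] by (auto simp: less_Suc_eq_le)
  from k obtain d' e' where de: "d = k * d'" "e = k * e'" by (auto elim!: dvdE)
  have m: "monic d'" "monic e'" using de k assms monic_mult_cancel by blast+
  have "coprime d' e'"
  proof (rule coprimeI)
    fix c assume c: "c dvd d'" "c dvd e'"
    then have nz: "c \<noteq> 0" using m by auto
    define c' where "c' = smult (inverse (lead_coeff c)) c"
    have c': "monic c'" "degree c' = degree c" "c' dvd d'" "c' dvd e'"
      using nz c by (auto simp: c'_def smult_dvd_iff)
    have "k * c' dvd d" "k * c' dvd e" using c'(3,4) by (simp_all add: de)
    moreover have "monic (k * c')" using k c'(1) by (intro monic_mult) auto
    ultimately have "?D (k * c')" by blast
    then have "degree (k * c') \<le> degree k" by (rule greatest)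
    moreover have "k \<noteq> 0" "c' \<noteq> 0" using k c' by auto
    ultimately have "degree c = 0" using c' by (simp add: degree_mult_eq)
    with nz show "is_unit c" by (simp add: is_unit_iff_degree)
  qed
  with that m de k show ?thesis by blast
qed

text \<open>A Bezout relation for \<open>d\<close> and \<open>e\<close> writes \<open>k\<close> as a
  combination of \<open>k * d\<close> and \<open>k * e\<close>, both multiples of
  \<open>k'\<close>.\<close>

lemma common_factor_dvd:
  fixes k k' d d' e e' :: "'a::field poly"
  assumes "coprime d e" "k * d = k' * d'" "k * e = k' * e'"
  shows "k' dvd k"
proof -
  obtain u v where uv: "u * d + v * e = 1" using poly_bezout[OF assms(1)] .
  have "k = k * (u * d + v * e)" by (simp add: uv)
  also have "\<dots> = u * (k * d) + v * (k * e)" by (simp add: algebra_simps)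
  also have "\<dots> = u * (k' * d') + v * (k' * e')" by (simp only: assms(2,3))
  also have "\<dots> = k' * (u * d' + v * e')" by (simp add: algebra_simps)
  finally show ?thesis by simp
qed

text \<open>Supplies the injectivity of both reparametrisations of pairs of monic polynomials by
  their gcd and a coprime pair.\<close>

lemma common_factor_unique:
  fixes k k' d d' e e' :: "'a::{field,finite} poly"
  assumes "coprime d e" "coprime d' e'" "monic k" "monic k'" "k * d = k' * d'" "k * e = k' * e'"
  shows "k = k'"
  using assms common_factor_dvd[of d e k k' d' e'] common_factor_dvd[of d' e' k' k d e]
  by (intro monic_dvd_antisym) auto

section \<open>Absolute value, multiplicities and \<open>big_Omega\<close>\<close>

lemma pabs_mult: "f \<noteq> 0 \<Longrightarrow> g \<noteq> 0 \<Longrightarrow> pabs (f * g) = pabs f * pabs g"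
  by (simp add: pabs_def degree_mult_eq power_add)

lemma pabs_one [simp]: "pabs 1 = 1"
  by (simp add: pabs_def)

lemma pabs_pos: "pabs f > 0"
  by (simp add: pabs_def)

text \<open>Evaluates the inner maximum of \<open>big_Omega\<close>: the admissible exponents are
  exactly \<open>0\<close> to \<open>n\<close>.\<close>

lemma max_power_dvd:
  fixes P :: "'a::{field,finite} poly"
  assumes "P \<in> monic_irreducibles" "\<not> P dvd g"
  shows "Max {m. P ^ m dvd P ^ n * g} = n"
proof -
  have "P \<noteq> 0" using assms by (auto simp: monic_irreducibles_def)
  have "m \<le> n" if "P ^ m dvd P ^ n * g" for m
  proof (rule ccontr)
    assume "\<not> m \<le> n"
    then have "P ^ m = P ^ n * (P * P ^ (m - Suc n))" by (simp flip: power_add power_Suc)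
    with that \<open>P \<noteq> 0\<close> have "P * P ^ (m - Suc n) dvd g" by simp
    with assms show False using dvd_mult_left by blast
  qed
  then have "{m. P ^ m dvd P ^ n * g} = {..n}" by (auto simp: le_imp_power_dvd)
  then show ?thesis by (auto intro: Max_eqI)
qed

lemma power_dvd_decompose:
  fixes P f :: "'a::{field,finite} poly"
  assumes "degree P > 0" "f \<noteq> 0"
  obtains n g where "f = P ^ n * g" "\<not> P dvd g"
  using assms(2)
proof (induction "degree f" arbitrary: f thesis rule: less_induct)
  case less
  show ?case
  proof (cases "P dvd f")
    case False
    then show ?thesis using less.prems(1)[of 0 f] by simp
  next
    case True
    then obtain f' where f': "f = P * f'" ..
    then have nz: "P \<noteq> 0" "f' \<noteq> 0" using less.prems by auto
    then have "degree f' < degree f" using f' assms by (simp add: degree_mult_eq)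
    from less.hyps[OF this _ nz(2)] obtain n g where "f' = P ^ n * g" "\<not> P dvd g" by blast
    then show ?thesis using less.prems(1)[of "Suc n" g] f' by (simp add: mult.assoc)
  qed
qed

text \<open>Since \<open>P\<close> is prime, the product of two cofactors not divisible by
  \<open>P\<close> is again not divisible by \<open>P\<close>, so the exponents add.\<close>

lemma max_power_dvd_mult:
  fixes P f g :: "'a::{field,finite} poly"
  assumes "P \<in> monic_irreducibles" "f \<noteq> 0" "g \<noteq> 0"
  shows "Max {n. P ^ n dvd f * g} = Max {n. P ^ n dvd f} + Max {n. P ^ n dvd g}"
proof -
  note deg = monic_irreducible_degree_pos[OF assms(1)]
  obtain n f' where f: "f = P ^ n * f'" "\<not> P dvd f'" using power_dvd_decompose[OF deg assms(2)] .
  obtain m g' where g: "g = P ^ m * g'" "\<not> P dvd g'" using power_dvd_decompose[OF deg assms(3)] .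
  have "\<not> P dvd f' * g'"
    using f g monic_irreducible_prime_elem[OF assms(1)] by (simp add: prime_elem_dvd_mult_iff)
  moreover have "f * g = P ^ (n + m) * (f' * g')" by (simp add: f g power_add algebra_simps)
  ultimately show ?thesis using f g assms max_power_dvd by metis
qed

lemma max_power_dvd_eq_0:
  fixes P f :: "'a::{field,finite} poly"
  assumes "P \<in> monic_irreducibles" "\<not> P dvd f"
  shows "Max {n. P ^ n dvd f} = 0"
  using max_power_dvd[OF assms, of 0] by simp

lemma finite_monic_irreducible_divisors:
  fixes f :: "'a::{field,finite} poly"
  assumes "f \<noteq> 0"
  shows "finite {P. P \<in> monic_irreducibles \<and> P dvd f}"
  by (rule finite_subset[OF _ finite_monic_divisors[OF assms]]) (auto simp: monic_irreducibles_def)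

lemma big_Omega_mult:
  fixes f g :: "'a::{field,finite} poly"
  assumes "f \<noteq> 0" "g \<noteq> 0"
  shows "big_Omega (f * g) = big_Omega f + big_Omega g"
proof -
  let ?D = "\<lambda>f. {P. P \<in> monic_irreducibles \<and> P dvd f}"
  \<comment> \<open>All sums are taken over the irreducible divisors of \<open>f * g\<close>; those
    that do not divide \<open>h\<close> contribute multiplicity \<open>0\<close>.\<close>
  have ext: "big_Omega h = (\<Sum>P\<in>?D (f * g). Max {n. P ^ n dvd h})" if "h = f \<or> h = g" for h
    unfolding big_Omega_def using that assms
    by (intro sum.mono_neutral_left finite_monic_irreducible_divisors)
       (auto simp: max_power_dvd_eq_0)
  have "big_Omega (f * g) = (\<Sum>P\<in>?D (f * g). Max {n. P ^ n dvd f} + Max {n. P ^ n dvd g})"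
    unfolding big_Omega_def using assms by (intro sum.cong) (auto simp: max_power_dvd_mult)
  then show ?thesis by (simp add: ext sum.distrib)
qed

lemma big_Omega_monic_irreducible:
  assumes "P \<in> monic_irreducibles"
  shows "big_Omega P = 1"
proof -
  have "\<not> P dvd 1" using assms by (auto simp: monic_irreducibles_def irreducible_def)
  then have "Max {n. P ^ n dvd P} = 1" using max_power_dvd[OF assms, of 1 1] by simp
  moreover have "{R. R \<in> monic_irreducibles \<and> R dvd P} = {P}"
    using assms monic_irreducible_dvd_eq by auto
  ultimately show ?thesis by (simp add: big_Omega_def)
qed

section \<open>Euler products\<close>

text \<open>Complex summability is absolute, so the products of terms are absolutely summable over
  the rectangle and the iterated sum is the sum over it.\<close>

lemma has_sum_product_complex:
  fixes f :: "'b \<Rightarrow> complex" and g :: "'c \<Rightarrow> complex"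
  assumes "(f has_sum a) A" "(g has_sum b) B"
  shows "((\<lambda>(x, y). f x * g y) has_sum (a * b)) (A \<times> B)"
proof (rule has_sum_SigmaI)
  show "((\<lambda>y. case (x, y) of (x, y) \<Rightarrow> f x * g y) has_sum f x * b) B" for x
    using has_sum_cmult_right[OF assms(2)] by simp
  show "((\<lambda>x. f x * b) has_sum a * b) A"
    using has_sum_cmult_left[OF assms(1)] .
  have f: "(\<lambda>x. norm (f x)) summable_on A" and g: "(\<lambda>y. norm (g y)) summable_on B"
    using assms has_sum_imp_summable summable_on_iff_abs_summable_on_complex by blast+
  have "(\<lambda>z. norm (case z of (x, y) \<Rightarrow> f x * g y)) summable_on A \<times> B"
    unfolding Infinite_Sum.abs_summable_on_Sigma_iff
  proof (intro conjI ballI)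
    show "(\<lambda>y. norm (case (x, y) of (x, y) \<Rightarrow> f x * g y)) summable_on B" for x
      using summable_on_cmult_right[OF g] by (simp add: norm_mult)
    have "(\<lambda>x. norm (f x) * infsum (\<lambda>y. norm (g y)) B) summable_on A"
      using summable_on_cmult_left[OF f] .
    then show "(\<lambda>x. norm (\<Sum>\<^sub>\<infinity>y\<in>B. norm (case (x, y) of (x, y) \<Rightarrow> f x * g y))) summable_on A"
      by (simp add: norm_mult infsum_cmult_right' abs_mult infsum_nonneg)
  qed
  then show "(\<lambda>(x, y). f x * g y) summable_on A \<times> B"
    by (simp add: summable_on_iff_abs_summable_on_complex)
qed

text \<open>The index set obtained by expanding the finite Euler product over \<open>S\<close> into
  a sum.\<close>

definition smooth :: "'a::{field,finite} poly set \<Rightarrow> 'a poly set" where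
  "smooth S = {f. monic f \<and> (\<forall>P\<in>monic_irreducibles. P dvd f \<longrightarrow> P \<in> S)}"

lemma smooth_empty: "smooth {} = {1 :: 'a::{field,finite} poly}"
proof -
  have "\<not> P dvd 1" if "P \<in> monic_irreducibles" for P :: "'a poly"
    using that by (auto simp: monic_irreducibles_def irreducible_def)
  then show ?thesis
    unfolding smooth_def by (auto elim: exists_monic_irreducible_dvd)
qed

text \<open>The exponent \<open>n\<close> is the exact power of \<open>P\<close> in the image, which
  gives injectivity. Passing from \<open>S\<close> to \<open>insert P S\<close> thus multiplies the
  sum over \<open>smooth S\<close> by one geometric series.\<close>

lemma bij_betw_smooth_insert:
  fixes P :: "'a::{field,finite} poly"
  assumes "P \<in> monic_irreducibles" "P \<notin> S"
  shows "bij_betw (\<lambda>(n, f). P ^ n * f) (UNIV \<times> smooth S) (smooth (insert P S))"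
proof (rule bij_betwI')
  have P0: "P \<noteq> 0" using assms by (auto simp: monic_irreducibles_def)
  have nd: "\<not> P dvd f" if "f \<in> smooth S" for f
    using that assms by (auto simp: smooth_def)
  fix x y assume "x \<in> (UNIV :: nat set) \<times> smooth S" "y \<in> (UNIV :: nat set) \<times> smooth S"
  then obtain n f m g where x: "x = (n, f)" "f \<in> smooth S" and y: "y = (m, g)" "g \<in> smooth S" by blast
  show "((case x of (n, f) \<Rightarrow> P ^ n * f) = (case y of (n, f) \<Rightarrow> P ^ n * f)) = (x = y)"
  proof
    assume "(case x of (n, f) \<Rightarrow> P ^ n * f) = (case y of (n, f) \<Rightarrow> P ^ n * f)"
    then have eq: "P ^ n * f = P ^ m * g" using x y by simp
    then have "n = m"
      using max_power_dvd[OF assms(1) nd[OF x(2)], of n] max_power_dvd[OF assms(1) nd[OF y(2)], of m]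
      by simp
    with eq P0 x y show "x = y" by simp
  qed simp
next
  have mP: "monic (P ^ n)" for n
    using assms by (auto simp: monic_irreducibles_def lead_coeff_power)
  fix x assume "x \<in> (UNIV :: nat set) \<times> smooth S"
  then obtain n f where x: "x = (n, f)" "f \<in> smooth S" by blast
  have "R \<in> insert P S" if "R \<in> monic_irreducibles" "R dvd P ^ n * f" for R
  proof -
    have pR: "prime_elem R" using monic_irreducible_prime_elem that(1) .
    have "R dvd P ^ n \<or> R dvd f" using that(2) unfolding prime_elem_dvd_mult_iff[OF pR] .
    then consider "R dvd P ^ n" | "R dvd f" by blast
    then show ?thesis
    proof cases
      case 1
      then have "R dvd P" by (rule prime_elem_dvd_power[OF pR])
      then show ?thesis using monic_irreducible_dvd_eq[OF that(1) assms(1)] by simp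
    next
      case 2
      then show ?thesis using x that by (simp add: smooth_def)
    qed
  qed
  moreover have "monic (P ^ n * f)" using mP[of n] x by (intro monic_mult) (auto simp: smooth_def)
  ultimately show "(case x of (n, f) \<Rightarrow> P ^ n * f) \<in> smooth (insert P S)"
    using x by (simp add: smooth_def)
next
  have mP: "monic (P ^ n)" for n
    using assms by (auto simp: monic_irreducibles_def lead_coeff_power)
  fix f assume f: "f \<in> smooth (insert P S)"
  then have "f \<noteq> 0" by (auto simp: smooth_def)
  then obtain n g where g: "f = P ^ n * g" "\<not> P dvd g"
    using power_dvd_decompose monic_irreducible_degree_pos assms(1) by metis
  then have "monic g" using f mP[of n] monic_mult_cancel[of "P ^ n" g] by (simp add: smooth_def)
  moreover have "R \<in> S" if "R \<in> monic_irreducibles" "R dvd g" for R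
  proof -
    have "R dvd f" using that g by simp
    with f that g show ?thesis by (auto simp: smooth_def)
  qed
  ultimately have "g \<in> smooth S" by (simp add: smooth_def)
  with g show "\<exists>x\<in>UNIV \<times> smooth S. f = (case x of (n, f) \<Rightarrow> P ^ n * f)"
    by (intro bexI[of _ "(n, g)"]) auto
qed

text \<open>The setting in which a sum over monic polynomials equals its Euler product. Summability
  of a complex family is automatically absolute, so tails can be bounded by sums of norms.\<close>

locale summable_completely_multiplicative =
  fixes h :: "'a::{field,finite} poly \<Rightarrow> complex"
  assumes one: "h 1 = 1"
    and mult: "\<And>f g. monic f \<Longrightarrow> monic g \<Longrightarrow> h (f * g) = h f * h g"
    and summable: "h summable_on {f. monic f}"
begin

lemma norm_summable: "(\<lambda>f. norm (h f)) summable_on {f. monic f}"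
  using summable by (simp add: summable_on_iff_abs_summable_on_complex)

lemma power: "monic f \<Longrightarrow> h (f ^ n) = h f ^ n"
  by (induction n) (auto simp: one mult lead_coeff_power)

text \<open>The powers of \<open>P\<close> are distinct monic polynomials, so the geometric series
  of \<open>norm (h P)\<close> is part of an absolutely convergent sum.\<close>

lemma norm_irreducible_less_one:
  assumes "P \<in> monic_irreducibles"
  shows "norm (h P) < 1"
proof -
  have mP: "monic P" using assms by (simp add: monic_irreducibles_def)
  have nd: "\<not> P dvd 1"
    using assms by (auto simp: monic_irreducibles_def irreducible_def)
  have inj: "inj (\<lambda>n. P ^ n)"
    using max_power_dvd[OF assms nd] by (intro injI) (metis mult.right_neutral)
  have "(\<lambda>f. norm (h f)) summable_on range (\<lambda>n. P ^ n)"
    by (rule summable_on_subset_banach[OF norm_summable]) (auto simp: lead_coeff_power mP)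
  then have "(\<lambda>n. norm (h P) ^ n) summable_on UNIV"
    by (simp add: summable_on_reindex[OF inj] o_def power mP norm_power)
  then have "summable (\<lambda>n. norm (h P) ^ n)" by (rule summable_on_imp_summable)
  then show ?thesis by (simp add: summable_geometric_iff)
qed

lemma has_sum_smooth:
  assumes "finite S" "S \<subseteq> monic_irreducibles"
  shows "(h has_sum (\<Prod>P\<in>S. inverse (1 - h P))) (smooth S)"
  using assms
proof (induction S)
  case empty
  then show ?case by (simp add: smooth_empty has_sum_finite_iff one)
next
  case (insert P S)
  have P: "P \<in> monic_irreducibles" and mP: "monic P"
    using insert.prems by (auto simp: monic_irreducibles_def)
  have "((\<lambda>n. h P ^ n) has_sum inverse (1 - h P)) UNIV"
    using geometric_sums[OF norm_irreducible_less_one[OF P]]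
      summable_geometric[of "norm (h P)"] norm_irreducible_less_one[OF P]
    by (intro norm_summable_imp_has_sum) (auto simp: norm_power divide_inverse)
  from has_sum_product_complex[OF this insert.IH] insert.prems
  have "((\<lambda>(n, f). h P ^ n * h f) has_sum inverse (1 - h P) * (\<Prod>P\<in>S. inverse (1 - h P)))
          (UNIV \<times> smooth S)" by simp
  moreover have "h P ^ n * h f = h (P ^ n * f)" if "f \<in> smooth S" for n f
    using that mP by (simp add: smooth_def mult power lead_coeff_power)
  ultimately have "((\<lambda>x. h (case x of (n, f) \<Rightarrow> P ^ n * f)) has_sum
      inverse (1 - h P) * (\<Prod>P\<in>S. inverse (1 - h P))) (UNIV \<times> smooth S)"
    by (subst has_sum_cong[of _ _ "\<lambda>(n, f). h P ^ n * h f"]) auto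
  then show ?case
    unfolding has_sum_reindex_bij_betw[OF bij_betw_smooth_insert[OF P insert.hyps(2)]]
    using insert.hyps by simp
qed

text \<open>A finite Euler product is the sum over \<open>smooth S\<close>, so its distance from the
  full sum is at most the sum of norms outside \<open>smooth S\<close>. This is small once
  \<open>smooth S\<close> contains a finite set carrying almost all of the absolute sum.\<close>

lemma euler_product:
  "((\<lambda>S. \<Prod>P\<in>S. inverse (1 - h P)) \<longlongrightarrow> infsum h {f. monic f})
     (finite_subsets_at_top monic_irreducibles)"
proof (rule tendstoI)
  fix \<epsilon> :: real assume "\<epsilon> > 0"
  let ?M = "{f :: 'a poly. monic f}"
  let ?n = "\<lambda>f. norm (h f)"
  \<comment> \<open>The approximation is not strict; asking for \<open>\<epsilon> / 2\<close> lets
    the final estimate be strictly below \<open>\<epsilon>\<close>.\<close>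
  obtain F where F: "finite F" "F \<subseteq> ?M" "dist (sum ?n F) (infsum ?n ?M) \<le> \<epsilon> / 2"
    using has_sum_finite_approximation[OF has_sum_infsum[OF norm_summable], of "\<epsilon> / 2"] \<open>\<epsilon> > 0\<close> by auto
  \<comment> \<open>With all irreducible factors of elements of \<open>F\<close> in
    \<open>S0\<close>, the inclusion \<open>S0 \<subseteq> S\<close> forces
    \<open>F \<subseteq> smooth S\<close>.\<close>
  define S0 where "S0 = (\<Union>f\<in>F. {P. P \<in> monic_irreducibles \<and> P dvd f})"
  have "finite S0" unfolding S0_def
    using F by (intro finite_UN_I finite_monic_irreducible_divisors) auto
  have "dist (\<Prod>P\<in>S. inverse (1 - h P)) (infsum h ?M) < \<epsilon>"
    if S: "finite S" "S0 \<subseteq> S" "S \<subseteq> monic_irreducibles" for S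
  proof -
    have sub: "smooth S \<subseteq> ?M" by (auto simp: smooth_def)
    have F_sub: "F \<subseteq> smooth S" using F S by (auto simp: smooth_def S0_def)
    have "(h has_sum (infsum h ?M - (\<Prod>P\<in>S. inverse (1 - h P)))) (?M - smooth S)"
      using has_sum_Diff[OF has_sum_infsum[OF summable] has_sum_smooth[OF S(1,3)] sub] .
    moreover have ns: "?n summable_on smooth S"
      using summable_on_subset_banach[OF norm_summable sub] .
    then have "(?n has_sum (infsum ?n ?M - infsum ?n (smooth S))) (?M - smooth S)"
      using has_sum_Diff[OF has_sum_infsum[OF norm_summable] has_sum_infsum[OF ns] sub] by simp
    ultimately have "norm (infsum h ?M - (\<Prod>P\<in>S. inverse (1 - h P)))
        \<le> infsum ?n ?M - infsum ?n (smooth S)"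
      using norm_has_sum_bound by blast
    also have "\<dots> \<le> infsum ?n ?M - sum ?n F"
      using finite_sum_le_infsum[OF ns F(1) F_sub] by simp
    also have "\<dots> \<le> dist (sum ?n F) (infsum ?n ?M)" by (simp add: dist_real_def)
    also have "\<dots> < \<epsilon>" using F(3) \<open>\<epsilon> > 0\<close> by simp
    finally show ?thesis by (simp add: dist_norm norm_minus_commute)
  qed
  moreover have "S0 \<subseteq> monic_irreducibles" by (auto simp: S0_def)
  ultimately show "\<forall>\<^sub>F S in finite_subsets_at_top monic_irreducibles.
      dist (\<Prod>P\<in>S. inverse (1 - h P)) (infsum h ?M) < \<epsilon>"
    using \<open>finite S0\<close> unfolding eventually_finite_subsets_at_top by blast
qed

text \<open>From \<open>norm (1 - h P) \<le> exp (norm (h P))\<close>, every finite Euler product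
  has norm at least \<open>exp (- ?T)\<close>, a bound independent of the finite set, so the limit
  keeps it. This justifies the division in Ramanujan's identity.\<close>

lemma infsum_nonzero: "infsum h {f. monic f} \<noteq> 0"
proof -
  let ?T = "infsum (\<lambda>f. norm (h f)) {f. monic f}"
  have bound: "exp (- ?T) \<le> norm (\<Prod>P\<in>S. inverse (1 - h P))"
    if S: "finite S" "S \<subseteq> monic_irreducibles" for S
  proof -
    have "(\<Sum>P\<in>S. norm (h P)) \<le> ?T"
      using S by (intro finite_sum_le_infsum norm_summable) (auto simp: monic_irreducibles_def)
    then have "exp (- ?T) \<le> exp (\<Sum>P\<in>S. - norm (h P))"
      by (simp add: sum_negf)
    also have "\<dots> = (\<Prod>P\<in>S. exp (- norm (h P)))" using S by (simp add: exp_sum)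
    also have "\<dots> \<le> (\<Prod>P\<in>S. norm (inverse (1 - h P)))"
    proof (intro prod_mono conjI)
      fix P assume "P \<in> S"
      with S have P: "norm (h P) < 1" using norm_irreducible_less_one by blast
      have "norm (1 - h P) \<le> 1 + norm (h P)" using norm_triangle_ineq4[of 1 "h P"] by simp
      also have "\<dots> \<le> exp (norm (h P))" by (rule exp_ge_add_one_self)
      finally have "norm (1 - h P) \<le> exp (norm (h P))" .
      moreover have "1 - h P \<noteq> 0" using P by auto
      ultimately show "exp (- norm (h P)) \<le> norm (inverse (1 - h P))"
        unfolding norm_inverse exp_minus by (intro le_imp_inverse_le) auto
    qed auto
    finally show ?thesis by (simp add: prod_norm)
  qed
  have "exp (- ?T) \<le> norm (infsum h {f. monic f})"
    by (rule tendsto_lowerbound[OF tendsto_norm[OF euler_product]])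
       (auto intro!: eventually_finite_subsets_at_top_weakI bound)
  then show ?thesis using exp_gt_zero[of "- ?T"] by auto
qed

end

section \<open>Ramanujan's identity\<close>

definition coprime_pairs :: "('a::{field,finite} poly \<times> 'a poly) set" where
  "coprime_pairs = {(d, e). monic d \<and> monic e \<and> coprime d e}"

lemma bij_betw_common_factor:
  "bij_betw (\<lambda>(k, d, e). (k * d, k * e)) ({f :: 'a::{field,finite} poly. monic f} \<times> coprime_pairs)
     ({f. monic f} \<times> {f. monic f})" (is "bij_betw ?b ?A ?B")
proof (rule bij_betwI')
  fix x y assume "x \<in> ?A" "y \<in> ?A"
  then obtain k d e k' d' e' where x: "x = (k, d, e)" "monic k" "coprime d e"
    and y: "y = (k', d', e')" "monic k'" "coprime d' e'" by (auto simp: coprime_pairs_def)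
  show "(?b x = ?b y) = (x = y)"
  proof
    assume "?b x = ?b y"
    then have eq: "k * d = k' * d'" "k * e = k' * e'" using x y by auto
    then have "k = k'" using common_factor_unique x y by blast
    moreover have "k \<noteq> 0" using x by auto
    ultimately show "x = y" using eq x y by simp
  qed simp
next
  fix x assume "x \<in> ?A"
  then show "?b x \<in> ?B"
    by (auto simp: coprime_pairs_def intro!: monic_mult)
next
  fix y assume "y \<in> ?B"
  then obtain d e where y: "y = (d, e)" "monic d" "monic e" by blast
  obtain k d' e' where "monic k" "monic d'" "monic e'" "coprime d' e'" "d = k * d'" "e = k * e'"
    using monic_common_factor[OF y(2,3)] .
  with y show "\<exists>x\<in>?A. y = ?b x"
    by (intro bexI[of _ "(k, d', e')"]) (auto simp: coprime_pairs_def)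
qed

text \<open>Two divisors \<open>k * d\<close> and \<open>k * e\<close> of \<open>f\<close>, with
  \<open>d\<close> and \<open>e\<close> coprime, have least common multiple
  \<open>k * d * e\<close>; the remaining factor \<open>m\<close> is the monic quotient of
  \<open>f\<close> by it.\<close>

lemma bij_betw_divisor_pairs:
  "bij_betw (\<lambda>(m, k, d, e). (m * k * d * e, k * d, k * e))
     ({f :: 'a::{field,finite} poly. monic f} \<times> {f. monic f} \<times> coprime_pairs)
     (SIGMA f:{f. monic f}. {d. d dvd f \<and> monic d} \<times> {d. d dvd f \<and> monic d})"
    (is "bij_betw ?b ?A ?B")
proof (rule bij_betwI')
  fix x y assume "x \<in> ?A" "y \<in> ?A"
  then obtain m k d e m' k' d' e' where
    x: "x = (m, k, d, e)" "monic m" "monic k" "monic d" "monic e" "coprime d e" and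
    y: "y = (m', k', d', e')" "monic m'" "monic k'" "monic d'" "monic e'" "coprime d' e'"
    by (auto simp: coprime_pairs_def)
  show "(?b x = ?b y) = (x = y)"
  proof
    assume "?b x = ?b y"
    then have eq: "m * k * d * e = m' * k' * d' * e'" "k * d = k' * d'" "k * e = k' * e'"
      using x y by auto
    then have "k = k'" using common_factor_unique[of d e d' e' k k'] x y by blast
    moreover have nz: "k \<noteq> 0" "d \<noteq> 0" "e \<noteq> 0" using x by auto
    ultimately have "d = d'" "e = e'" using eq by auto
    with \<open>k = k'\<close> nz eq show "x = y" using x y by simp
  qed simp
next
  fix x assume "x \<in> ?A"
  then show "?b x \<in> ?B"
    by (auto simp: coprime_pairs_def lead_coeff_mult)
next
  fix y assume "y \<in> ?B"
  then obtain f d e where y: "y = (f, d, e)" "monic f" "d dvd f" "monic d" "e dvd f" "monic e" by blast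
  then obtain k d' e' where k: "monic k" "monic d'" "monic e'" "coprime d' e'" "d = k * d'" "e = k * e'"
    using monic_common_factor[of d e] by blast
  then have "k dvd f" using y by (metis dvd_mult_left)
  then obtain f' where f': "f = k * f'" ..
  have "k \<noteq> 0" using k by auto
  then have "d' dvd f'" "e' dvd f'" using y k f' by auto
  then have "d' * e' dvd f'" using poly_coprime_mult_dvd k by blast
  then obtain m where m: "f' = d' * e' * m" ..
  then have f: "f = (k * d' * e') * m" using f' by (simp add: algebra_simps)
  moreover have "monic (k * d' * e')" using k by (simp add: lead_coeff_mult)
  ultimately have "monic m" using y monic_mult_cancel[of "k * d' * e'" m] by simp
  moreover have "f = m * k * d' * e'" using f by (simp add: algebra_simps)
  ultimately show "\<exists>x\<in>?A. y = ?b x"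
    using y k by (intro bexI[of _ "(m, k, d', e')"]) (auto simp: coprime_pairs_def)
qed

text \<open>\<open>g\<close> may vanish, as it does in the application on all nonconstant monic
  polynomials when \<open>y = 0\<close>. Multiplicativity of \<open>u\<close> and \<open>v\<close>
  therefore cannot be recovered from that of the products with \<open>g\<close> and is assumed
  separately.\<close>

theorem ramanujan_identity:
  fixes g u v :: "'a::{field,finite} poly \<Rightarrow> complex"
  assumes g: "summable_completely_multiplicative g"
    and ug: "summable_completely_multiplicative (\<lambda>f. u f * g f)"
    and vg: "summable_completely_multiplicative (\<lambda>f. v f * g f)"
    and uvg: "summable_completely_multiplicative (\<lambda>f. u f * v f * g f)"
    and uvgg: "summable_completely_multiplicative (\<lambda>f. u f * v f * g f ^ 2)"
    and u: "\<And>f g. monic f \<Longrightarrow> monic g \<Longrightarrow> u (f * g) = u f * u g"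
    and v: "\<And>f g. monic f \<Longrightarrow> monic g \<Longrightarrow> v (f * g) = v f * v g"
  shows "((\<lambda>f. g f * ((\<Sum>d | d dvd f \<and> monic d. u d) * (\<Sum>d | d dvd f \<and> monic d. v d))) has_sum
    (infsum g {f. monic f} * infsum (\<lambda>f. u f * v f * g f) {f. monic f}
      / infsum (\<lambda>f. u f * v f * g f ^ 2) {f. monic f})
     * (infsum (\<lambda>f. u f * g f) {f. monic f} * infsum (\<lambda>f. v f * g f) {f. monic f})) {f. monic f}"
proof -
  let ?M = "{f :: 'a poly. monic f}"
  interpret g: summable_completely_multiplicative g by fact
  interpret ug: summable_completely_multiplicative "\<lambda>f. u f * g f" by fact
  interpret vg: summable_completely_multiplicative "\<lambda>f. v f * g f" by fact
  interpret uvg: summable_completely_multiplicative "\<lambda>f. u f * v f * g f" by fact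
  interpret uvgg: summable_completely_multiplicative "\<lambda>f. u f * v f * g f ^ 2" by fact
  let ?c = "\<lambda>(d, e). (u d * g d) * (v e * g e)"
  have prod: "(?c has_sum infsum (\<lambda>f. u f * g f) ?M * infsum (\<lambda>f. v f * g f) ?M) (?M \<times> ?M)"
    by (intro has_sum_product_complex has_sum_infsum ug.summable vg.summable)
  have "coprime_pairs \<subseteq> ?M \<times> ?M" by (auto simp: coprime_pairs_def)
  then have c: "?c summable_on coprime_pairs"
    using summable_on_subset_banach[OF has_sum_imp_summable[OF prod]] by blast
  define S where "S = infsum ?c coprime_pairs"
  have S: "(?c has_sum S) coprime_pairs" unfolding S_def using c by (rule has_sum_infsum)
  \<comment> \<open>At \<open>(k * d, k * e)\<close> the summand \<open>?c\<close> is its value at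
    \<open>(d, e)\<close> times \<open>u k * v k * g k ^ 2\<close>, so the full double sum is a
    single series times the coprime sum \<open>S\<close>.\<close>
  have "((\<lambda>(k, x). (u k * v k * g k ^ 2) * ?c x) has_sum
      infsum (\<lambda>f. u f * v f * g f ^ 2) ?M * S) (?M \<times> coprime_pairs)"
    by (intro has_sum_product_complex has_sum_infsum uvgg.summable S)
  also have "?this \<longleftrightarrow> ((\<lambda>x. ?c (case x of (k, d, e) \<Rightarrow> (k * d, k * e))) has_sum
      infsum (\<lambda>f. u f * v f * g f ^ 2) ?M * S) (?M \<times> coprime_pairs)"
    by (intro has_sum_cong)
       (auto simp: coprime_pairs_def u v g.mult power2_eq_square)
  also have "\<dots> \<longleftrightarrow> (?c has_sum infsum (\<lambda>f. u f * v f * g f ^ 2) ?M * S) (?M \<times> ?M)"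
    by (rule has_sum_reindex_bij_betw[OF bij_betw_common_factor])
  finally have "infsum (\<lambda>f. u f * v f * g f ^ 2) ?M * S
      = infsum (\<lambda>f. u f * g f) ?M * infsum (\<lambda>f. v f * g f) ?M"
    using prod has_sum_unique by blast
  \<comment> \<open>Solving for \<open>S\<close> divides by a series that is nonzero by its Euler
    product.\<close>
  then have S_eq: "S = infsum (\<lambda>f. u f * g f) ?M * infsum (\<lambda>f. v f * g f) ?M
      / infsum (\<lambda>f. u f * v f * g f ^ 2) ?M"
    using uvgg.infsum_nonzero by (simp add: field_simps)
  let ?t = "\<lambda>(f, d, e). g f * (u d * v e)"
  let ?b = "\<lambda>(m, k, d, e). (m * k * d * e, k * d, k * e)"
  let ?S = "infsum g ?M * (infsum (\<lambda>f. u f * v f * g f) ?M * S)"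
  \<comment> \<open>The weight \<open>g (m * k * d * e)\<close> splits into four factors:
    \<open>g m\<close> stands alone, \<open>g k\<close> joins \<open>u k * v k\<close>, and the
    other two complete \<open>?c (d, e)\<close>. Here \<open>g k\<close> occurs once, in contrast to
    its square above.\<close>
  have "((\<lambda>(m, y). g m * (\<lambda>(k, x). (u k * v k * g k) * ?c x) y) has_sum ?S)
      (?M \<times> ?M \<times> coprime_pairs)"
    by (intro has_sum_product_complex has_sum_infsum uvg.summable g.summable S)
  also have "?this \<longleftrightarrow> ((\<lambda>x. ?t (?b x)) has_sum ?S) (?M \<times> ?M \<times> coprime_pairs)"
    by (intro has_sum_cong)
       (auto simp: coprime_pairs_def u v g.mult lead_coeff_mult)
  also have "\<dots> \<longleftrightarrow>
      (?t has_sum ?S) (SIGMA f:?M. {d. d dvd f \<and> monic d} \<times> {d. d dvd f \<and> monic d})"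
    by (rule has_sum_reindex_bij_betw[OF bij_betw_divisor_pairs])
  \<comment> \<open>Regrouping by \<open>f\<close> leaves a finite inner sum over pairs of divisors,
    which is the product of the two divisor sums.\<close>
  finally have "((\<lambda>f. g f * ((\<Sum>d | d dvd f \<and> monic d. u d) * (\<Sum>d | d dvd f \<and> monic d. v d))) has_sum ?S) ?M"
  proof (rule has_sum_Sigma')
    fix f assume "f \<in> ?M"
    then have fin: "finite {d. d dvd f \<and> monic d}" by (intro finite_monic_divisors) auto
    then show "((\<lambda>y. ?t (f, y)) has_sum
        g f * ((\<Sum>d | d dvd f \<and> monic d. u d) * (\<Sum>d | d dvd f \<and> monic d. v d)))
        ({d. d dvd f \<and> monic d} \<times> {d. d dvd f \<and> monic d})"
      unfolding sum_product unfolding sum_distrib_left sum.cartesian_product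
      by (intro has_sum_finiteI) (auto intro!: sum.cong)
  qed
  then show ?thesis by (simp add: S_eq mult.assoc)
qed

section \<open>Characters of finite abelian groups\<close>

text \<open>Every root of a \<open>z\<close> other than \<open>1\<close> differs from
  \<open>1\<close>, and \<open>1\<close> itself has \<open>m \<ge> 2\<close> distinct roots. The
  freedom to avoid \<open>1\<close> is what makes characters separate elements.\<close>

lemma exists_nontrivial_root:
  fixes z :: complex
  assumes "m \<ge> 2" "z \<noteq> 0"
  obtains w where "w ^ m = z" "w \<noteq> 1"
proof (cases "z = 1")
  case True
  have "card {w::complex. w ^ m = 1} = m"
    using assms(1) by (intro card_roots_unity_eq) auto
  then have "\<not> {w::complex. w ^ m = 1} \<subseteq> {1}"
    using card_mono[of "{1::complex}" "{w. w ^ m = 1}"] assms(1) by auto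
  with True that show ?thesis by auto
next
  case False
  have "(exp (Ln z / of_nat m)) ^ m = z"
    using assms by (simp flip: exp_of_nat_mult)
  moreover from this False have "exp (Ln z / of_nat m) \<noteq> 1" by auto
  ultimately show ?thesis using that by blast
qed

text \<open>Pigeonhole: two powers of \<open>g\<close> coincide, and the smaller one can be
  cancelled.\<close>

lemma (in group) finite_pow_eq_one:
  assumes "finite (carrier G)" "g \<in> carrier G"
  obtains n :: nat where "n > 0" "g [^] n = \<one>"
proof -
  have "range (\<lambda>n::nat. g [^] n) \<subseteq> carrier G"
    using assms(2) by auto
  then have "finite (range (\<lambda>n::nat. g [^] n))"
    using assms(1) finite_subset by blast
  then have "\<not> inj (\<lambda>n::nat. g [^] n)"
    using finite_imageD by blast
  then obtain i j :: nat where ij: "i < j" "g [^] i = g [^] j"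
    unfolding inj_def by (metis linorder_neqE_nat)
  have "g [^] i \<otimes> g [^] (j - i) = g [^] (i + (j - i))"
    using assms(2) by (rule nat_pow_mult)
  then have "g [^] i \<otimes> g [^] (j - i) = g [^] i"
    using ij by simp
  then have "g [^] (j - i) = \<one>"
    using assms(2) by simp
  with ij that[of "j - i"] show ?thesis by simp
qed

text \<open>A character known on the subgroup \<open>H\<close>. The values of \<open>chi\<close>
  outside \<open>H\<close> are arbitrary, so extending a character means changing \<open>chi\<close>
  there.\<close>

locale partial_character = comm_group G for G (structure) +
  fixes H :: "'a set" and chi :: "'a \<Rightarrow> complex"
  assumes subgroup: "subgroup H G"
    and one: "chi \<one> = 1"
    and mult: "\<And>x y. x \<in> H \<Longrightarrow> y \<in> H \<Longrightarrow> chi (x \<otimes> y) = chi x * chi y"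
begin

lemma carrier_H: "x \<in> H \<Longrightarrow> x \<in> carrier G"
  using subgroup.mem_carrier[OF subgroup] .

lemma pow_closed: "x \<in> H \<Longrightarrow> x [^] (n::nat) \<in> H"
  using subgroup by (induction n) (auto simp: subgroup.one_closed subgroup.m_closed)

lemma pow: "x \<in> H \<Longrightarrow> chi (x [^] (n::nat)) = chi x ^ n"
  by (induction n) (auto simp: one mult pow_closed)

lemma nonzero: "x \<in> H \<Longrightarrow> chi x \<noteq> 0"
  using mult[of x "inv x"] one subgroup carrier_H[of x]
  by (metis mult_zero_left r_inv subgroup.m_inv_closed zero_neq_one)

text \<open>Let \<open>m\<close> be the least positive exponent with \<open>g [^] m \<in> H\<close>.
  Sending \<open>g\<close> to any \<open>z\<close> with \<open>z ^ m = chi (g [^] m)\<close> extends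
  \<open>chi\<close> to the subgroup generated by \<open>H\<close> and \<open>g\<close>. As
  \<open>g \<notin> H\<close>, \<open>m \<ge> 2\<close>, so \<open>z\<close> can be chosen different
  from \<open>1\<close>.\<close>

lemma extend_step:
  assumes fin: "finite (carrier G)" and g: "g \<in> carrier G" "g \<notin> H"
  obtains H' psi where "partial_character G H' psi" "insert g H \<subseteq> H'"
    "\<And>x. x \<in> H \<Longrightarrow> psi x = chi x" "psi g \<noteq> 1"
proof -
  \<comment> \<open>\<open>N\<close> shows that \<open>m\<close> exists, and it later expresses
    inverses of powers of \<open>g\<close> with natural exponents.\<close>
  obtain N :: nat where N: "N > 0" "g [^] N = \<one>"
    using finite_pow_eq_one[OF fin g(1)] .
  define m where "m = (LEAST n::nat. n > 0 \<and> g [^] n \<in> H)"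
  have "0 < N \<and> g [^] N \<in> H"
    using N subgroup by (simp add: subgroup.one_closed)
  then have m: "m > 0" "g [^] m \<in> H"
    unfolding m_def by (metis (mono_tags, lifting) LeastI)+
  have m_le: "m \<le> n" if "n > 0" "g [^] n \<in> H" for n
    unfolding m_def by (rule Least_le) (use that in auto)
  have "m \<noteq> 1" using m g nat_pow_Suc[of g 0] by auto
  with m have "m \<ge> 2" by simp
  then obtain z where z: "z ^ m = chi (g [^] m)" "z \<noteq> 1"
    using exists_nontrivial_root[of m "chi (g [^] m)"] nonzero[OF m(2)] by blast
  have "z \<noteq> 0" using z nonzero[OF m(2)] m(1) by (metis power_0_left less_irrefl)
  \<comment> \<open>Dividing \<open>k\<close> by \<open>m\<close> leaves a power
    \<open>g [^] (k mod m)\<close> in \<open>H\<close>, so the remainder is \<open>0\<close> by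
    minimality of \<open>m\<close>.\<close>
  have gpow: "chi (g [^] k) = z ^ k" if "g [^] k \<in> H" for k
  proof -
    have k: "k = m * (k div m) + k mod m" by simp
    have gm: "(g [^] m) [^] (k div m) \<in> H" using m pow_closed by blast
    have eq: "g [^] k = (g [^] m) [^] (k div m) \<otimes> g [^] (k mod m)"
      using g by (subst k) (simp add: nat_pow_mult nat_pow_pow)
    have "g [^] (k mod m) = inv ((g [^] m) [^] (k div m)) \<otimes> g [^] k"
      using g eq by (simp add: inv_solve_left)
    then have "g [^] (k mod m) \<in> H"
      using subgroup gm that by (simp add: subgroup.m_closed subgroup.m_inv_closed)
    then have "k mod m = 0"
      using m_le[of "k mod m"] m by (meson mod_less_divisor not_le gr0I)
    with eq g have "chi (g [^] k) = chi ((g [^] m) [^] (k div m))" by simp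
    also have "\<dots> = z ^ k"
      using \<open>k mod m = 0\<close> k z m by (metis add.right_neutral pow power_mult)
    finally show ?thesis .
  qed
  \<comment> \<open>The extension must not depend on the representation
    \<open>h \<otimes> g [^] k\<close>. Natural exponents make the case \<open>k \<le> l\<close> the
    basic one; the general case follows by symmetry.\<close>
  have wd: "chi h * z ^ k = chi h' * z ^ l"
    if "h \<in> H" "h' \<in> H" "h \<otimes> g [^] k = h' \<otimes> g [^] l" "k \<le> l" for h h' k l
  proof -
    have c: "h \<in> carrier G" "h' \<in> carrier G" using that carrier_H by auto
    have "h \<otimes> g [^] k = (h' \<otimes> g [^] (l - k)) \<otimes> g [^] k"
      using that g c by (simp add: m_assoc nat_pow_mult)
    then have h: "h = h' \<otimes> g [^] (l - k)"
      using g c by (metis m_closed nat_pow_closed right_cancel)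
    then have "g [^] (l - k) = inv h' \<otimes> h"
      using g c by (simp add: inv_solve_left)
    then have "g [^] (l - k) \<in> H"
      using that subgroup by (simp add: subgroup.m_closed subgroup.m_inv_closed)
    then have "chi h = chi h' * z ^ (l - k)"
      using h gpow mult that by metis
    then show ?thesis using that by (simp flip: power_add)
  qed
  have wd: "chi h * z ^ k = chi h' * z ^ l"
    if "h \<in> H" "h' \<in> H" "h \<otimes> g [^] k = h' \<otimes> g [^] l" for h h' k l
    using wd[of h h' k l] wd[of h' h l k] that by (metis linorder_le_cases)
  define H' where "H' = {h \<otimes> g [^] k | h k. h \<in> H \<and> k \<in> (UNIV::nat set)}"
  define psi where "psi = (\<lambda>x. THE w. \<exists>h\<in>H. \<exists>k::nat. x = h \<otimes> g [^] k \<and> w = chi h * z ^ k)"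
  have psi: "psi (h \<otimes> g [^] k) = chi h * z ^ k" if "h \<in> H" for h and k :: nat
    unfolding psi_def using that by (intro the_equality) (blast, metis wd)
  have one_H: "\<one> \<in> H" using subgroup by (simp add: subgroup.one_closed)
  have prod: "(h \<otimes> g [^] k) \<otimes> (h' \<otimes> g [^] l) = (h \<otimes> h') \<otimes> g [^] (k + l)"
    if "h \<in> H" "h' \<in> H" for h h' and k l :: nat
    using carrier_H[OF that(1)] carrier_H[OF that(2)] g by (simp add: m_ac flip: nat_pow_mult)
  have HH: "h \<otimes> h' \<in> H" if "h \<in> H" "h' \<in> H" for h h'
    using subgroup that by (simp add: subgroup.m_closed)
  have sub: "subgroup H' G"
  proof (rule subgroupI)
    show "H' \<subseteq> carrier G" using g carrier_H by (auto simp: H'_def)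
    show "H' \<noteq> {}" using one_H by (auto simp: H'_def)
    show "x \<otimes> y \<in> H'" if "x \<in> H'" "y \<in> H'" for x y
      using that prod HH unfolding H'_def by blast
    show "inv x \<in> H'" if "x \<in> H'" for x
    proof -
      from that obtain h k where hk: "h \<in> H" "x = h \<otimes> g [^] (k::nat)" by (auto simp: H'_def)
      have ih: "inv h \<in> H" using hk subgroup by (simp add: subgroup.m_inv_closed)
      \<comment> \<open>The exponent \<open>k * (N - 1)\<close> inverts \<open>g [^] k\<close>,
        because the exponents add up to \<open>N * k\<close> and
        \<open>g [^] N = \<one>\<close>.\<close>
      have "x \<otimes> (inv h \<otimes> g [^] (k * (N - 1))) = (h \<otimes> inv h) \<otimes> g [^] (k + k * (N - 1))"
        using prod[OF hk(1) ih] hk by simp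
      also have "k + k * (N - 1) = N * k" using N by (cases N) auto
      also have "g [^] (N * k) = \<one>" using N g by (simp flip: nat_pow_pow)
      finally have "x \<otimes> (inv h \<otimes> g [^] (k * (N - 1))) = \<one>"
        using carrier_H[OF hk(1)] by simp
      then have "inv x = inv h \<otimes> g [^] (k * (N - 1))"
        using hk ih carrier_H g by (intro inv_equality) (auto simp: m_comm)
      with ih show ?thesis by (auto simp: H'_def)
    qed
  qed
  have psi_H: "psi x = chi x" if "x \<in> H" for x
    using psi[OF that, of 0] carrier_H[OF that] by simp
  show thesis
  proof
    show "partial_character G H' psi"
    proof (intro partial_character.intro partial_character_axioms.intro)
      show "psi \<one> = 1" using psi_H one_H one by simp
      show "psi (x \<otimes> y) = psi x * psi y" if "x \<in> H'" "y \<in> H'" for x y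
        using that unfolding H'_def by (auto simp: prod psi HH mult power_add)
    qed (rule comm_group_axioms sub)+
    have "h \<in> H'" if "h \<in> H" for h
      using that carrier_H[OF that] by (auto simp: H'_def intro!: exI[of _ h] exI[of _ 0])
    moreover have "g \<in> H'" using one_H g by (auto simp: H'_def intro!: exI[of _ \<one>] exI[of _ 1])
    ultimately show "insert g H \<subseteq> H'" by blast
    show "psi x = chi x" if "x \<in> H" for x using psi_H that .
    show "psi g \<noteq> 1" using psi[OF one_H, of 1] g z one by simp
  qed
qed

end

text \<open>Adjoining one missing element at a time reaches the whole group, since the number of
  elements outside the subgroup decreases.\<close>

lemma partial_character_extend:
  assumes "partial_character G H chi" "finite (carrier G)"
  shows "\<exists>psi. partial_character G (carrier G) psi \<and> (\<forall>x\<in>H. psi x = chi x)"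
  using assms(1)
proof (induction "card (carrier G - H)" arbitrary: H chi rule: less_induct)
  case less
  interpret partial_character G H chi by fact
  show ?case
  proof (cases "H = carrier G")
    case True
    with less.prems show ?thesis by blast
  next
    case False
    with carrier_H obtain g where g: "g \<in> carrier G" "g \<notin> H" by blast
    then obtain H' psi where H': "partial_character G H' psi" "insert g H \<subseteq> H'"
      "\<And>x. x \<in> H \<Longrightarrow> psi x = chi x"
      using extend_step assms(2) by metis
    have "card (carrier G - H') < card (carrier G - H)"
      using g H' assms(2) by (intro psubset_card_mono) auto
    from less.hyps[OF this H'(1)] obtain psi'
      where psi': "partial_character G (carrier G) psi'" "\<forall>x\<in>H'. psi' x = psi x" by blast
    have "\<forall>x\<in>H. psi' x = chi x"
      using psi'(2) H'(2,3) by auto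
    with psi'(1) show ?thesis by blast
  qed
qed

text \<open>The first extension starts from the trivial subgroup and adjoins \<open>g\<close> with a
  value other than \<open>1\<close>; later extensions preserve that value.\<close>

lemma (in comm_group) exists_separating_character:
  assumes "finite (carrier G)" "g \<in> carrier G" "g \<noteq> \<one>"
  obtains chi where "partial_character G (carrier G) chi" "chi g \<noteq> 1"
proof -
  have triv: "partial_character G {\<one>} (\<lambda>_. 1)"
  proof (rule partial_character.intro[OF comm_group_axioms partial_character_axioms.intro])
    show "subgroup {\<one>} G" by (rule triv_subgroup)
    show "(1::complex) = 1" by (rule refl)
    show "(1::complex) = 1 * 1" by simp
  qed
  have g: "g \<notin> {\<one>}" using assms(3) by simp
  show ?thesis
  proof (rule partial_character.extend_step[OF triv assms(1,2) g])
    fix H chi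
    assume H: "partial_character G H chi" "insert g {\<one>} \<subseteq> H" "chi g \<noteq> 1"
    obtain psi where psi: "partial_character G (carrier G) psi" "\<forall>x\<in>H. psi x = chi x"
      using partial_character_extend[OF H(1) assms(1)] by blast
    from psi(2) H(2) have "psi g = chi g" by blast
    with H(3) have "psi g \<noteq> 1" by simp
    with psi(1) show ?thesis by (rule that)
  qed
qed

section \<open>Orthogonality of Dirichlet characters\<close>

lemma reduced_residues_iff:
  "h \<in> reduced_residues Q \<longleftrightarrow> h mod Q = h \<and> coprime h Q"
  by (simp add: reduced_residues_def poly_coprime_iff_invertible)

lemma mod_mem_reduced_residues:
  fixes f Q :: "'a::{field,finite} poly"
  shows "coprime f Q \<Longrightarrow> f mod Q \<in> reduced_residues Q"
  using poly_coprime_cong[of "f mod Q" f Q] by (simp add: reduced_residues_iff)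

lemma finite_reduced_residues:
  fixes Q :: "'a::{field,finite} poly"
  assumes "Q \<noteq> 0"
  shows "finite (reduced_residues Q)"
proof (rule finite_subset[OF _ finite_degree_le[of "degree Q"]])
  show "reduced_residues Q \<subseteq> {p. degree p \<le> degree Q}"
  proof
    fix h assume "h \<in> reduced_residues Q"
    then have "h = 0 \<or> degree h < degree Q"
      using degree_mod_less[OF assms, of h] by (simp add: reduced_residues_iff)
    then show "h \<in> {p. degree p \<le> degree Q}" by auto
  qed
qed

text \<open>The identity is \<open>1 mod Q\<close> and not \<open>1\<close>, because for a nonzero
  constant \<open>Q\<close> the only residue is \<open>0\<close>.\<close>

definition unit_group :: "'a::{field,finite} poly \<Rightarrow> 'a poly monoid" where
  "unit_group Q = \<lparr>carrier = reduced_residues Q, monoid.mult = (\<lambda>f g. f * g mod Q), one = 1 mod Q\<rparr>"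

lemma unit_group_simps [simp]:
  "carrier (unit_group Q) = reduced_residues Q"
  "f \<otimes>\<^bsub>unit_group Q\<^esub> g = f * g mod Q"
  "\<one>\<^bsub>unit_group Q\<^esub> = 1 mod Q"
  by (simp_all add: unit_group_def)

lemma comm_group_unit_group: "comm_group (unit_group Q)"
proof (rule comm_groupI)
  show "\<exists>y\<in>carrier (unit_group Q). y \<otimes>\<^bsub>unit_group Q\<^esub> x = \<one>\<^bsub>unit_group Q\<^esub>"
    if x: "x \<in> carrier (unit_group Q)" for x
  proof -
    from x obtain g where g: "[x * g = 1] (mod Q)"
      by (auto simp: reduced_residues_def)
    then have "[g * x = 1] (mod Q)" by (simp add: mult.commute)
    then have "coprime g Q" using poly_coprime_iff_invertible by blast
    moreover have "(g mod Q) * x mod Q = 1 mod Q"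
      using \<open>[g * x = 1] (mod Q)\<close> by (simp add: cong_def mod_mult_left_eq)
    ultimately show ?thesis using mod_mem_reduced_residues by auto
  qed
next
  show "x \<otimes>\<^bsub>unit_group Q\<^esub> y \<in> carrier (unit_group Q)"
    if "x \<in> carrier (unit_group Q)" "y \<in> carrier (unit_group Q)" for x y
    using that mod_mem_reduced_residues[of "x * y" Q]
    by (simp add: reduced_residues_iff poly_coprime_mult_left_iff)
next
  show "\<one>\<^bsub>unit_group Q\<^esub> \<otimes>\<^bsub>unit_group Q\<^esub> x = x" if "x \<in> carrier (unit_group Q)" for x
  proof -
    have "(1 mod Q) * x mod Q = 1 * x mod Q" by (rule mod_mult_left_eq)
    with that show ?thesis by (simp add: reduced_residues_iff)
  qed
next
  show "x \<otimes>\<^bsub>unit_group Q\<^esub> y \<otimes>\<^bsub>unit_group Q\<^esub> z = x \<otimes>\<^bsub>unit_group Q\<^esub> (y \<otimes>\<^bsub>unit_group Q\<^esub> z)" for x y z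
    by (simp add: mod_mult_left_eq mod_mult_right_eq mult.assoc)
next
  show "x \<otimes>\<^bsub>unit_group Q\<^esub> y = y \<otimes>\<^bsub>unit_group Q\<^esub> x" for x y
    by (simp add: mult.commute)
qed (use mod_mem_reduced_residues[of 1 Q] in simp)

lemma unit_group_pow: "f [^]\<^bsub>unit_group Q\<^esub> (n::nat) = f ^ n mod Q"
  by (induction n) (simp_all add: mod_mult_right_eq mult.commute)

lemma exists_pow_cong_one:
  fixes f Q :: "'a::{field,finite} poly"
  assumes "Q \<noteq> 0" "coprime f Q"
  obtains n :: nat where "n > 0" "[f ^ n = 1] (mod Q)"
proof -
  interpret comm_group "unit_group Q" by (rule comm_group_unit_group)
  have "finite (carrier (unit_group Q))" "f mod Q \<in> carrier (unit_group Q)"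
    using assms by (simp_all add: finite_reduced_residues mod_mem_reduced_residues)
  then obtain n :: nat where "n > 0" "(f mod Q) [^]\<^bsub>unit_group Q\<^esub> n = \<one>\<^bsub>unit_group Q\<^esub>"
    by (rule finite_pow_eq_one)
  then show ?thesis using that by (simp add: unit_group_pow power_mod cong_def)
qed

lemma exists_separating_dirichlet_char:
  fixes d Q :: "'a::{field,finite} poly"
  assumes "Q \<noteq> 0" "coprime d Q" "\<not> [d = 1] (mod Q)"
  obtains chi where "dirichlet_char Q chi" "chi d \<noteq> 1"
proof -
  obtain psi where psi: "partial_character (unit_group Q) (carrier (unit_group Q)) psi" "psi (d mod Q) \<noteq> 1"
  proof (rule comm_group.exists_separating_character[OF comm_group_unit_group[of Q], of "d mod Q"])
    show "d mod Q \<noteq> \<one>\<^bsub>unit_group Q\<^esub>" using assms(3) by (simp add: cong_def)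
  qed (use assms finite_reduced_residues mod_mem_reduced_residues in auto)
  define chi where "chi = (\<lambda>f. if coprime f Q then psi (f mod Q) else 0)"
  have mult: "psi (f * g mod Q) = psi (f mod Q) * psi (g mod Q)" if "coprime f Q" "coprime g Q" for f g
    using partial_character.mult[OF psi(1), of "f mod Q" "g mod Q"] that
    by (simp add: mod_mem_reduced_residues mod_mult_eq)
  have "dirichlet_char Q chi"
    unfolding dirichlet_char_def
  proof (intro conjI allI impI)
    show "chi f = chi g" if "[f = g] (mod Q)" for f g
      using that poly_coprime_cong[OF that] by (simp add: chi_def cong_def)
    show "chi (f * g) = chi f * chi g" for f g
      by (simp add: chi_def poly_coprime_mult_left_iff mult)
    show "chi f \<noteq> 0 \<longleftrightarrow> coprime f Q" for f
      using partial_character.nonzero[OF psi(1), of "f mod Q"] mod_mem_reduced_residues[of f Q]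
      by (simp add: chi_def)
  qed
  moreover have "chi d \<noteq> 1" using psi assms by (simp add: chi_def)
  ultimately show ?thesis by (rule that)
qed

section \<open>Basic properties of Dirichlet characters and the orthogonality relations\<close>

lemma dirichlet_char_cong: "dirichlet_char Q chi \<Longrightarrow> [f = g] (mod Q) \<Longrightarrow> chi f = chi g"
  by (simp add: dirichlet_char_def)

lemma dirichlet_char_mult: "dirichlet_char Q chi \<Longrightarrow> chi (f * g) = chi f * chi g"
  by (simp add: dirichlet_char_def)

lemma dirichlet_char_eq_0: "dirichlet_char Q chi \<Longrightarrow> chi f = 0 \<longleftrightarrow> \<not> coprime f Q"
  unfolding dirichlet_char_def by blast

lemma dirichlet_char_one: "dirichlet_char Q chi \<Longrightarrow> chi 1 = 1"
  using dirichlet_char_mult[of Q chi 1 1] dirichlet_char_eq_0[of Q chi 1] by simp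

lemma dirichlet_char_power: "dirichlet_char Q chi \<Longrightarrow> chi (f ^ n) = chi f ^ n"
  by (induction n) (simp_all add: dirichlet_char_one dirichlet_char_mult)

lemma dirichlet_char_principal: "dirichlet_char Q (principal_char Q)"
  using poly_coprime_cong[of _ _ Q]
  by (simp add: dirichlet_char_def principal_char_def poly_coprime_mult_left_iff)

lemma dirichlet_char_cnj: "dirichlet_char Q chi \<Longrightarrow> dirichlet_char Q (\<lambda>f. cnj (chi f))"
  by (simp add: dirichlet_char_def)

lemma dirichlet_char_times:
  "dirichlet_char Q chi \<Longrightarrow> dirichlet_char Q psi \<Longrightarrow> dirichlet_char Q (\<lambda>f. chi f * psi f)"
  by (simp add: dirichlet_char_def)

lemma dirichlet_char_eqI:
  assumes "dirichlet_char Q chi" "dirichlet_char Q psi" "\<And>h. h \<in> reduced_residues Q \<Longrightarrow> chi h = psi h"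
  shows "chi = psi"
proof
  fix f
  show "chi f = psi f"
  proof (cases "coprime f Q")
    case True
    have "chi f = chi (f mod Q)" "psi f = psi (f mod Q)"
      using assms(1,2) by (auto intro!: dirichlet_char_cong)
    with assms(3)[OF mod_mem_reduced_residues[OF True]] show ?thesis by simp
  next
    case False
    with assms(1,2) have "chi f = 0" "psi f = 0" by (simp_all add: dirichlet_char_eq_0)
    then show ?thesis by simp
  qed
qed

context
  fixes Q :: "'a::{field,finite} poly"
  assumes Q: "Q \<noteq> 0"
begin

text \<open>\<open>f\<close> has finite order modulo \<open>Q\<close>, so \<open>chi f\<close> is a
  root of unity.\<close>

lemma dirichlet_char_norm:
  assumes "dirichlet_char Q chi" "coprime f Q"
  shows "norm (chi f) = 1"
proof -
  obtain n :: nat where n: "n > 0" "[f ^ n = 1] (mod Q)" using exists_pow_cong_one[OF Q assms(2)] .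
  then have "chi f ^ n = 1"
    using dirichlet_char_cong[OF assms(1) n(2)] assms(1)
    by (simp add: dirichlet_char_power dirichlet_char_one)
  then have "norm (chi f) ^ n = 1 ^ n" by (simp flip: norm_power)
  then show ?thesis using n(1) by (metis norm_ge_zero power_eq_imp_eq_base zero_le_one)
qed

lemma dirichlet_char_norm_le: "dirichlet_char Q chi \<Longrightarrow> norm (chi f) \<le> 1"
  using dirichlet_char_norm[of chi f] dirichlet_char_eq_0[of Q chi f] by (cases "coprime f Q") auto

lemma dirichlet_char_mult_cnj: "dirichlet_char Q chi \<Longrightarrow> chi f * cnj (chi f) = principal_char Q f"
  using dirichlet_char_norm[of chi f] dirichlet_char_eq_0[of Q chi f]
  by (simp add: principal_char_def complex_norm_square[symmetric])

text \<open>A character is determined by its values on the finitely many reduced residues, and its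
  value at \<open>h\<close> is a root of unity whose exponent \<open>n h\<close> does not depend on
  the character.\<close>

lemma finite_dirichlet_chars: "finite {chi. dirichlet_char Q chi}"
proof -
  let ?R = "reduced_residues Q"
  have "\<forall>h\<in>?R. \<exists>n::nat. n > 0 \<and> [h ^ n = 1] (mod Q)"
    using exists_pow_cong_one[OF Q] by (metis reduced_residues_iff)
  then obtain n :: "'a poly \<Rightarrow> nat" where n: "\<forall>h\<in>?R. n h > 0 \<and> [h ^ n h = 1] (mod Q)" by metis
  let ?r = "\<lambda>chi. restrict chi ?R"
  have "?r ` {chi. dirichlet_char Q chi} \<subseteq> (\<Pi>\<^sub>E h\<in>?R. {z::complex. z ^ n h = 1})"
  proof
    fix p assume "p \<in> ?r ` {chi. dirichlet_char Q chi}"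
    then obtain chi where chi: "dirichlet_char Q chi" "p = ?r chi" by blast
    have "chi h ^ n h = 1" if "h \<in> ?R" for h
      using dirichlet_char_cong[OF chi(1), of "h ^ n h" 1] n that chi(1)
      by (simp add: dirichlet_char_power dirichlet_char_one)
    with chi show "p \<in> (\<Pi>\<^sub>E h\<in>?R. {z. z ^ n h = 1})" by auto
  qed
  moreover have "finite (\<Pi>\<^sub>E h\<in>?R. {z::complex. z ^ n h = 1})"
    using n by (intro finite_PiE finite_reduced_residues[OF Q] finite_roots_unity) auto
  ultimately have "finite (?r ` {chi. dirichlet_char Q chi})" by (rule finite_subset)
  moreover have "inj_on ?r {chi. dirichlet_char Q chi}"
  proof (rule inj_onI)
    fix chi psi assume *: "chi \<in> {chi. dirichlet_char Q chi}" "psi \<in> {chi. dirichlet_char Q chi}" "?r chi = ?r psi"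
    have "chi h = psi h" if "h \<in> ?R" for h
      using fun_cong[OF *(3), of h] that by simp
    with * show "chi = psi" by (intro dirichlet_char_eqI) auto
  qed
  ultimately show ?thesis by (rule finite_imageD)
qed

lemma Phi_pos: "Phi Q > 0"
  using finite_reduced_residues[OF Q] mod_mem_reduced_residues[of 1 Q]
  by (auto simp: Phi_def card_gt_0_iff)

text \<open>For a non-principal \<open>chi\<close>, multiplication by some \<open>g\<close> with
  \<open>chi g \<noteq> 1\<close> permutes the reduced residues, so the sum equals
  \<open>chi g\<close> times itself.\<close>

lemma sum_dirichlet_char_residues:
  assumes chi: "dirichlet_char Q chi"
  shows "(\<Sum>h\<in>reduced_residues Q. chi h) = (if chi = principal_char Q then of_nat (Phi Q) else 0)"
proof (cases "chi = principal_char Q")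
  case True
  then show ?thesis by (simp add: principal_char_def reduced_residues_iff Phi_def)
next
  case False
  let ?R = "reduced_residues Q"
  obtain g where g: "g \<in> ?R" "chi g \<noteq> 1"
  proof (rule ccontr)
    assume "\<not> thesis"
    with that have "chi h = principal_char Q h" if "h \<in> ?R" for h
      using \<open>h \<in> ?R\<close> by (auto simp: principal_char_def reduced_residues_iff)
    with False show False
      using dirichlet_char_eqI[OF chi dirichlet_char_principal] by blast
  qed
  have gQ: "coprime g Q" using g by (simp add: reduced_residues_iff)
  have inj: "inj_on (\<lambda>h. g * h mod Q) ?R"
  proof (rule inj_onI)
    fix h k assume hk: "h \<in> ?R" "k \<in> ?R" "g * h mod Q = g * k mod Q"
    then have "Q dvd g * (h - k)" by (simp add: mod_eq_dvd_iff algebra_simps)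
    moreover have "coprime Q g" using gQ by (rule coprime_commute[THEN iffD1])
    ultimately have "Q dvd h - k" using poly_coprime_dvd_mult by blast
    then have "h mod Q = k mod Q" by (simp add: mod_eq_dvd_iff)
    with hk show "h = k" by (simp add: reduced_residues_iff)
  qed
  have sub: "(\<lambda>h. g * h mod Q) ` ?R \<subseteq> ?R"
  proof safe
    fix h assume "h \<in> ?R"
    then have "coprime (g * h) Q" using gQ by (simp add: reduced_residues_iff poly_coprime_mult_left_iff)
    then show "g * h mod Q \<in> ?R" by (rule mod_mem_reduced_residues)
  qed
  have img: "(\<lambda>h. g * h mod Q) ` ?R = ?R"
    using finite_reduced_residues[OF Q] sub inj by (rule endo_inj_surj)
  have "(\<Sum>h\<in>?R. chi h) = (\<Sum>h\<in>(\<lambda>h. g * h mod Q) ` ?R. chi h)" by (simp only: img)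
  also have "\<dots> = (\<Sum>h\<in>?R. chi (g * h mod Q))"
    by (subst sum.reindex[OF inj]) simp
  also have "\<dots> = (\<Sum>h\<in>?R. chi g * chi h)"
  proof (rule sum.cong)
    fix h
    have "chi (g * h mod Q) = chi (g * h)" by (rule dirichlet_char_cong[OF chi]) simp
    then show "chi (g * h mod Q) = chi g * chi h" using chi by (simp add: dirichlet_char_mult)
  qed simp
  finally have "(\<Sum>h\<in>?R. chi h) = chi g * (\<Sum>h\<in>?R. chi h)"
    unfolding sum_distrib_left .
  from iffD1[OF mult_cancel_right1 this] g False show ?thesis by simp
qed

text \<open>The dual argument: multiplication by a character \<open>psi\<close> with
  \<open>psi d \<noteq> 1\<close> permutes the characters, its inverse being multiplication by the
  conjugate of \<open>psi\<close>.\<close>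

lemma sum_dirichlet_chars_eq_0:
  assumes "\<not> [d = 1] (mod Q)"
  shows "(\<Sum>chi | dirichlet_char Q chi. chi d) = 0"
proof (cases "coprime d Q")
  case False
  then show ?thesis by (intro sum.neutral) (auto simp: dirichlet_char_eq_0)
next
  case True
  obtain psi where psi: "dirichlet_char Q psi" "psi d \<noteq> 1"
    using exists_separating_dirichlet_char[OF Q True assms] .
  have psi_cnj: "psi f * cnj (psi f) * chi f = chi f" if "dirichlet_char Q chi" for chi f
    using that psi by (auto simp: dirichlet_char_mult_cnj principal_char_def dirichlet_char_eq_0)
  have "(\<Sum>chi | dirichlet_char Q chi. chi d) = (\<Sum>chi | dirichlet_char Q chi. psi d * chi d)"
    by (rule sum.reindex_bij_witness[of _ "\<lambda>chi f. psi f * chi f" "\<lambda>chi f. cnj (psi f) * chi f"])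
       (use psi(1) psi_cnj in \<open>auto simp: fun_eq_iff mult_ac intro!: dirichlet_char_times dirichlet_char_cnj\<close>)
  then have "(\<Sum>chi | dirichlet_char Q chi. chi d) = psi d * (\<Sum>chi | dirichlet_char Q chi. chi d)"
    unfolding sum_distrib_left .
  from iffD1[OF mult_cancel_right1 this] psi show ?thesis by blast
qed

text \<open>Double counting of \<open>chi h\<close> over all characters and reduced residues:
  summing over characters first leaves only the class of \<open>1\<close>, summing over residues
  first leaves only the principal character.\<close>

lemma card_dirichlet_chars: "card {chi. dirichlet_char Q chi} = Phi Q"
proof -
  let ?R = "reduced_residues Q" and ?C = "{chi. dirichlet_char Q chi}"
  have one: "1 mod Q \<in> ?R" by (rule mod_mem_reduced_residues) simp
  have "(\<Sum>h\<in>?R. \<Sum>chi\<in>?C. chi h) = (\<Sum>h\<in>{1 mod Q}. \<Sum>chi\<in>?C. chi h)"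
    using one finite_reduced_residues[OF Q]
    by (intro sum.mono_neutral_right)
       (auto simp: reduced_residues_iff cong_def intro!: sum_dirichlet_chars_eq_0)
  also have "\<dots> = (\<Sum>chi\<in>?C. chi (1 mod Q))" by simp
  also have "\<dots> = (\<Sum>chi\<in>?C. 1)"
  proof (intro sum.cong refl)
    show "chi (1 mod Q) = 1" if "chi \<in> ?C" for chi
      using that dirichlet_char_cong[of Q chi "1 mod Q" 1] by (simp add: dirichlet_char_one)
  qed
  finally have "of_nat (card ?C) = (\<Sum>chi\<in>?C. \<Sum>h\<in>?R. chi h)"
    by (subst sum.swap) simp
  also have "\<dots> = (\<Sum>chi\<in>?C. if chi = principal_char Q then of_nat (Phi Q) else 0)"
    by (intro sum.cong) (auto simp: sum_dirichlet_char_residues)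
  also have "\<dots> = (of_nat (Phi Q) :: complex)"
    using finite_dirichlet_chars dirichlet_char_principal[of Q] by simp
  finally show ?thesis by (simp only: of_nat_eq_iff)
qed

lemma sum_dirichlet_chars_cong:
  assumes "coprime h Q"
  shows "(\<Sum>chi | dirichlet_char Q chi. cnj (chi h) * chi d) = (if [d = h] (mod Q) then of_nat (Phi Q) else 0)"
proof (cases "[d = h] (mod Q)")
  case True
  have "cnj (chi h) * chi d = 1" if "dirichlet_char Q chi" for chi
    using dirichlet_char_cong[OF that True] dirichlet_char_mult_cnj[OF that, of h] assms
    by (simp add: principal_char_def mult.commute)
  with True show ?thesis by (simp add: card_dirichlet_chars)
next
  case False
  obtain g where g: "[h * g = 1] (mod Q)" using assms poly_coprime_iff_invertible by blast
  \<comment> \<open>Conjugation at \<open>h\<close> is evaluation at its inverse \<open>g\<close>,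
    so the sum becomes one of \<open>chi (g * d)\<close>, where \<open>g * d\<close> is not
    congruent to \<open>1\<close>.\<close>
  have cnj: "cnj (chi h) = chi g" if "dirichlet_char Q chi" for chi
  proof -
    have "chi h * chi g = 1"
      using dirichlet_char_cong[OF that g] that by (simp add: dirichlet_char_mult dirichlet_char_one)
    moreover have "chi h * cnj (chi h) = 1"
      using dirichlet_char_mult_cnj[OF that, of h] assms by (simp add: principal_char_def)
    moreover have "chi h \<noteq> 0" using that assms by (simp add: dirichlet_char_eq_0)
    ultimately show ?thesis by (metis mult_left_cancel)
  qed
  have "\<not> [g * d = 1] (mod Q)"
  proof
    assume "[g * d = 1] (mod Q)"
    then have "[h * (g * d) = h * 1] (mod Q)" by (rule cong_scalar_left)
    moreover have "[h * g * d = 1 * d] (mod Q)" using g by (rule cong_scalar_right)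
    ultimately have "[d = h] (mod Q)" by (metis cong_sym cong_trans mult.assoc mult_1 mult_1_right)
    with False show False ..
  qed
  then have "(\<Sum>chi | dirichlet_char Q chi. chi (g * d)) = 0" by (rule sum_dirichlet_chars_eq_0)
  with False cnj show ?thesis by (simp add: dirichlet_char_mult)
qed

text \<open>The square in the variance is an algebraic one, so expanding it produces products of two
  conjugated characters. Orthogonality keeps exactly the pairs in which one character is the
  conjugate of the other.\<close>

lemma variance_sigma_eq:
  fixes f :: "'a poly"
  assumes "f \<noteq> 0"
  shows "variance_sigma a f Q = 1 / of_nat (Phi Q) ^ 2 *
    (\<Sum>chi | dirichlet_char Q chi \<and> chi \<noteq> principal_char Q.
       (\<Sum>d | d dvd f \<and> monic d. chi d * of_nat (pabs d) powr a) *
       (\<Sum>d | d dvd f \<and> monic d. cnj (chi d) * of_nat (pabs d) powr a))"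
proof -
  define D where "D = {d. d dvd f \<and> monic d}"
  define C where "C = {chi. dirichlet_char Q chi}"
  define N where "N = {chi. dirichlet_char Q chi \<and> chi \<noteq> principal_char Q}"
  define \<sigma> where "\<sigma> chi = (\<Sum>d\<in>D. chi d * of_nat (pabs d) powr a)" for chi :: "'a poly \<Rightarrow> complex"
  let ?R = "reduced_residues Q" and ?P = "of_nat (Phi Q) :: complex"
  have D: "finite D" unfolding D_def using assms by (rule finite_monic_divisors)
  have C: "finite C" unfolding C_def by (rule finite_dirichlet_chars)
  have N: "finite N" "C = insert (principal_char Q) N" "principal_char Q \<notin> N"
    using C dirichlet_char_principal by (auto simp: C_def N_def intro: finite_subset)
  have P: "?P \<noteq> 0" using Phi_pos by simp
  have residue: "sigma_residue a f h Q = (\<Sum>chi\<in>C. cnj (chi h) * \<sigma> chi) / ?P" if h: "h \<in> ?R" for h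
  proof -
    have "sigma_residue a f h Q = (\<Sum>d\<in>D. if [d = h] (mod Q) then of_nat (pabs d) powr a else 0)"
      unfolding sigma_residue_def D_def using D
      by (simp add: D_def sum.inter_filter[symmetric] conj_ac)
    also have "\<dots> = (\<Sum>d\<in>D. (\<Sum>chi\<in>C. cnj (chi h) * chi d) / ?P * of_nat (pabs d) powr a)"
      using h P unfolding C_def by (intro sum.cong) (auto simp: sum_dirichlet_chars_cong reduced_residues_iff)
    also have "\<dots> = (\<Sum>d\<in>D. \<Sum>chi\<in>C. cnj (chi h) * (chi d * of_nat (pabs d) powr a) / ?P)"
      unfolding sum_divide_distrib sum_distrib_right by (intro sum.cong refl) (simp add: mult.assoc)
    also have "\<dots> = (\<Sum>chi\<in>C. cnj (chi h) * \<sigma> chi) / ?P"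
      by (subst sum.swap) (simp add: \<sigma>_def sum_divide_distrib sum_distrib_left)
    finally show ?thesis .
  qed
  have coprime: "sigma_coprime a f Q = \<sigma> (principal_char Q)"
  proof -
    have "sigma_coprime a f Q = (\<Sum>d\<in>D. if coprime d Q then of_nat (pabs d) powr a else 0)"
      unfolding sigma_coprime_def D_def using D
      by (simp add: D_def sum.inter_filter[symmetric] conj_ac)
    also have "\<dots> = \<sigma> (principal_char Q)"
      unfolding \<sigma>_def by (intro sum.cong) (auto simp: principal_char_def)
    finally show ?thesis .
  qed
  \<comment> \<open>The principal character contributes exactly the mean, so subtracting the mean
    removes its term.\<close>
  have diff: "sigma_residue a f h Q - sigma_coprime a f Q / ?P = (\<Sum>chi\<in>N. cnj (chi h) * \<sigma> chi) / ?P"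
    if h: "h \<in> ?R" for h
  proof -
    have "principal_char Q h = 1" using h by (simp add: principal_char_def reduced_residues_iff)
    with N h show ?thesis by (simp add: residue coprime add_divide_distrib)
  qed
  have orth: "(\<Sum>h\<in>?R. cnj (chi h) * cnj (psi h)) = (if psi = (\<lambda>f. cnj (chi f)) then ?P else 0)"
    if "chi \<in> N" "psi \<in> N" for chi psi
  proof -
    have c: "dirichlet_char Q chi" "dirichlet_char Q psi" using that by (auto simp: N_def)
    let ?w = "\<lambda>f. cnj (chi f) * cnj (psi f)"
    have w: "dirichlet_char Q ?w" by (intro dirichlet_char_times dirichlet_char_cnj c)
    have "?w = principal_char Q \<longleftrightarrow> psi = (\<lambda>f. cnj (chi f))"
    proof
      assume eq: "?w = principal_char Q"
      show "psi = (\<lambda>f. cnj (chi f))"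
      proof
        fix f
        show "psi f = cnj (chi f)"
        proof (cases "coprime f Q")
          case True
          then have "cnj (chi f) * cnj (psi f) = 1" "psi f * cnj (psi f) = 1"
            using fun_cong[OF eq, of f] dirichlet_char_mult_cnj[OF c(2), of f]
            by (simp_all add: principal_char_def)
          then show ?thesis by (metis mult_right_cancel mult_zero_right zero_neq_one)
        next
          case False
          with c have "chi f = 0" "psi f = 0" by (simp_all add: dirichlet_char_eq_0)
          then show ?thesis by simp
        qed
      qed
    next
      assume "psi = (\<lambda>f. cnj (chi f))"
      then show "?w = principal_char Q"
        using dirichlet_char_mult_cnj[OF c(1)] by (simp add: fun_eq_iff mult.commute)
    qed
    then show ?thesis using sum_dirichlet_char_residues[OF w] by simp
  qed
  \<comment> \<open>The surviving index, the conjugate of \<open>chi\<close>, has to lie in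
    \<open>N\<close> for the inner sum to pick up its term.\<close>
  have cnj_N: "(\<lambda>f. cnj (chi f)) \<in> N" if "chi \<in> N" for chi
  proof -
    have "chi = principal_char Q" if "(\<lambda>f. cnj (chi f)) = principal_char Q"
    proof
      fix f
      have "cnj (cnj (chi f)) = cnj (principal_char Q f)" using fun_cong[OF that, of f] by simp
      then show "chi f = principal_char Q f" by (simp add: principal_char_def split: if_splits)
    qed
    with \<open>chi \<in> N\<close> dirichlet_char_cnj show ?thesis by (auto simp: N_def)
  qed
  have "(\<Sum>h\<in>?R. (sigma_residue a f h Q - sigma_coprime a f Q / ?P)\<^sup>2)
      = (\<Sum>h\<in>?R. \<Sum>chi\<in>N. \<Sum>psi\<in>N. (cnj (chi h) * cnj (psi h)) * (\<sigma> chi * \<sigma> psi / ?P\<^sup>2))"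
    by (intro sum.cong refl)
       (simp add: diff power2_eq_square sum_product sum_divide_distrib mult_ac)
  also have "\<dots> = (\<Sum>chi\<in>N. \<Sum>psi\<in>N. (\<Sum>h\<in>?R. cnj (chi h) * cnj (psi h)) * (\<sigma> chi * \<sigma> psi / ?P\<^sup>2))"
    by (subst sum.swap, intro sum.cong refl, subst sum.swap) (simp only: sum_distrib_right)
  also have "\<dots> = (\<Sum>chi\<in>N. \<sigma> chi * \<sigma> (\<lambda>f. cnj (chi f)) / ?P)"
  proof (intro sum.cong refl)
    fix chi assume chi: "chi \<in> N"
    have "(\<Sum>psi\<in>N. (\<Sum>h\<in>?R. cnj (chi h) * cnj (psi h)) * (\<sigma> chi * \<sigma> psi / ?P\<^sup>2))
        = (\<Sum>psi\<in>N. if psi = (\<lambda>f. cnj (chi f)) then ?P * (\<sigma> chi * \<sigma> psi / ?P\<^sup>2) else 0)"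
      by (intro sum.cong) (auto simp: orth chi)
    also have "\<dots> = \<sigma> chi * \<sigma> (\<lambda>f. cnj (chi f)) / ?P"
      using N cnj_N[OF chi] P by (simp add: power2_eq_square)
    finally show "(\<Sum>psi\<in>N. (\<Sum>h\<in>?R. cnj (chi h) * cnj (psi h)) * (\<sigma> chi * \<sigma> psi / ?P\<^sup>2))
        = \<sigma> chi * \<sigma> (\<lambda>f. cnj (chi f)) / ?P" .
  qed
  finally show ?thesis
    unfolding variance_sigma_def
    by (simp add: \<sigma>_def D_def N_def power2_eq_square flip: sum_divide_distrib)
qed

end

section \<open>The Dirichlet series of the variance\<close>

text \<open>Grouped by degree, the at most \<open>CARD('a) ^ n\<close> monic polynomials of degree
  \<open>n\<close> contribute at most \<open>r ^ n\<close> with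
  \<open>r = CARD('a) powr (1 - \<sigma>)\<close>. Here \<open>r < 1\<close>, since a field has at
  least two elements.\<close>

lemma summable_on_pabs_powr:
  assumes "\<sigma> > 1"
  shows "(\<lambda>f :: 'a::{field,finite} poly. real (pabs f) powr (-\<sigma>)) summable_on {f. monic f}"
proof (rule nonneg_bdd_above_summable_on)
  have "card {0, 1 :: 'a} \<le> CARD('a)" by (rule card_mono) auto
  then have q: "real CARD('a) \<ge> 2" by simp
  define r where "r = real CARD('a) powr (1 - \<sigma>)"
  have r: "0 \<le> r" "r < 1"
    using q assms powr_less_one[of "real CARD('a)" "1 - \<sigma>"] by (simp_all add: r_def)
  let ?p = "\<lambda>f :: 'a poly. real (pabs f) powr (-\<sigma>)"
  show "bdd_above (sum ?p ` {F. F \<subseteq> {f. monic f} \<and> finite F})"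
  proof (rule bdd_aboveI2)
    fix F :: "'a poly set" assume "F \<in> {F. F \<subseteq> {f. monic f} \<and> finite F}"
    then have F: "F \<subseteq> {f. monic f}" "finite F" by auto
    have "sum ?p F = (\<Sum>n\<in>degree ` F. sum ?p {f \<in> F. degree f = n})"
      using F(2) by (rule sum.image_gen)
    also have "\<dots> \<le> (\<Sum>n\<in>degree ` F. r ^ n)"
    proof (rule sum_mono)
      fix n
      have q_pow: "real (CARD('a) ^ n) = real CARD('a) powr real n"
        using q by (simp add: powr_realpow)
      have "sum ?p {f \<in> F. degree f = n} = card {f \<in> F. degree f = n} * real (CARD('a) ^ n) powr (-\<sigma>)"
        by (simp add: pabs_def)
      also have "\<dots> \<le> real (CARD('a) ^ n) * real (CARD('a) ^ n) powr (-\<sigma>)"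
      proof (rule mult_right_mono)
        have "card {f \<in> F. degree f = n} \<le> card {f :: 'a poly. monic f \<and> degree f = n}"
          using F(1) finite_monic_degree by (intro card_mono) auto
        also have "\<dots> \<le> CARD('a) ^ n" by (rule card_monic_degree_le)
        finally show "real (card {f \<in> F. degree f = n}) \<le> real (CARD('a) ^ n)"
          by (rule of_nat_mono)
      qed simp
      also have "\<dots> = real CARD('a) powr (real n * (1 - \<sigma>))"
        unfolding q_pow powr_powr by (simp add: powr_add[symmetric] algebra_simps)
      also have "\<dots> = r ^ n"
        unfolding r_def using q by (simp add: powr_powr mult.commute flip: powr_realpow)
      finally show "sum ?p {f \<in> F. degree f = n} \<le> r ^ n" .
    qed
    also have "\<dots> \<le> (\<Sum>n. r ^ n)"
      using F(2) r by (intro sum_le_suminf summable_geometric) auto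
    finally show "sum ?p F \<le> (\<Sum>n. r ^ n)" .
  qed
qed simp

text \<open>Complex \<open>powr\<close> is not multiplicative in its base in general; it is here
  because the bases are positive reals.\<close>

lemma pabs_powr_mult:
  fixes f g :: "'a::{field,finite} poly"
  assumes "f \<noteq> 0" "g \<noteq> 0"
  shows "complex_of_nat (pabs (f * g)) powr z = of_nat (pabs f) powr z * of_nat (pabs g) powr z"
proof -
  have "(complex_of_real (real (pabs f)) * of_real (real (pabs g))) powr z
      = of_real (real (pabs f)) powr z * of_real (real (pabs g)) powr z"
    by (rule powr_times_real) auto
  with assms show ?thesis by (simp add: pabs_mult)
qed

lemma norm_pabs_powr: "norm (complex_of_nat (pabs f) powr z) = real (pabs f) powr Re z"
  using norm_powr_real_powr[of "of_nat (pabs f)" z] by simp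

text \<open>For \<open>norm y \<le> 1\<close> the terms are dominated by
  \<open>pabs f powr (- Re z)\<close>. The general bounded \<open>chi\<close> covers the constant
  \<open>1\<close> of \<open>zeta_A\<close>, the principal character and all other characters at
  once.\<close>

lemma summable_completely_multiplicative_twist:
  fixes chi :: "'a::{field,finite} poly \<Rightarrow> complex"
  assumes one: "chi 1 = 1" and mult: "\<And>f g. chi (f * g) = chi f * chi g"
    and norm: "\<And>f. norm (chi f) \<le> 1" and y: "norm y \<le> 1" and z: "Re z > 1"
  shows "summable_completely_multiplicative (\<lambda>f. y ^ big_Omega f * chi f * of_nat (pabs f) powr (-z))"
proof
  have "big_Omega (1 :: 'a poly) = 0" using big_Omega_mult[of "1 :: 'a poly" 1] by simp
  then show "y ^ big_Omega (1 :: 'a poly) * chi 1 * of_nat (pabs (1 :: 'a poly)) powr (-z) = 1"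
    using one by simp
  show "y ^ big_Omega (f * g) * chi (f * g) * of_nat (pabs (f * g)) powr (-z) =
      y ^ big_Omega f * chi f * of_nat (pabs f) powr (-z) *
      (y ^ big_Omega g * chi g * of_nat (pabs g) powr (-z))"
    if "monic f" "monic g" for f g :: "'a poly"
  proof -
    have "f \<noteq> 0" "g \<noteq> 0" using that by auto
    then show ?thesis by (simp add: big_Omega_mult pabs_powr_mult mult power_add mult_ac)
  qed
  have "norm (y ^ big_Omega f * chi f * of_nat (pabs f) powr (-z)) \<le> real (pabs f) powr (- Re z)"
    for f :: "'a poly"
  proof -
    have "norm (y ^ big_Omega f) * norm (chi f) \<le> 1 * 1"
      using y norm by (intro mult_mono) (auto simp: norm_power power_le_one)
    then show ?thesis
      using mult_right_mono[of "norm (y ^ big_Omega f) * norm (chi f)" 1 "real (pabs f) powr (- Re z)"]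
      by (simp add: norm_mult norm_pabs_powr)
  qed
  then have "(\<lambda>f :: 'a poly. norm (y ^ big_Omega f * chi f * of_nat (pabs f) powr (-z))) summable_on {f. monic f}"
    by (intro Infinite_Sum.abs_summable_on_comparison_test'[OF summable_on_pabs_powr[OF z]]) auto
  then show "(\<lambda>f :: 'a poly. y ^ big_Omega f * chi f * of_nat (pabs f) powr (-z)) summable_on {f. monic f}"
    by (simp add: summable_on_iff_abs_summable_on_complex)
qed

text \<open>Since \<open>big_Omega P = 1\<close>, the Euler factors of the twisted function are
  those of \<open>L_fun\<close>. The convergence of the Euler product ensures that
  \<open>infprod\<close> takes its intended value.\<close>

lemma L_fun_eq_infsum:
  fixes chi :: "'a::{field,finite} poly \<Rightarrow> complex"
  assumes "chi 1 = 1" "\<And>f g. chi (f * g) = chi f * chi g"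
    "\<And>f. norm (chi f) \<le> 1" "norm y \<le> 1" "Re z > 1"
  shows "L_fun z chi y = infsum (\<lambda>f. y ^ big_Omega f * chi f * of_nat (pabs f) powr (-z)) {f. monic f}"
proof -
  let ?h = "\<lambda>f. y ^ big_Omega f * chi f * of_nat (pabs f) powr (-z)"
  interpret summable_completely_multiplicative ?h
    by (rule summable_completely_multiplicative_twist[OF assms])
  have "\<forall>\<^sub>F S in finite_subsets_at_top monic_irreducibles.
      (\<Prod>P\<in>S. inverse (1 - ?h P)) = (\<Prod>P\<in>S. inverse (1 - y * chi P * of_nat (pabs P) powr (-z)))"
    by (intro eventually_finite_subsets_at_top_weakI prod.cong refl)
       (auto dest!: subsetD simp: big_Omega_monic_irreducible)
  from Lim_transform_eventually[OF euler_product this] show ?thesis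
    unfolding L_fun_def infprod_def by (intro tendsto_Lim) simp_all
qed

lemma zeta_A_eq_L_fun: "zeta_A TYPE('a::{field,finite}) z y = L_fun z (\<lambda>_ :: 'a poly. 1) y"
  by (simp add: zeta_A_def L_fun_def)

text \<open>Ramanujan's identity for \<open>u\<close> and \<open>v\<close> built from
  \<open>chi\<close> and its conjugate. The conditions on \<open>s\<close>, \<open>s - a\<close>,
  \<open>s - 2 * a\<close> and \<open>2 * s - 2 * a\<close> give convergence of the series of
  \<open>g\<close>, of \<open>u g\<close> and \<open>v g\<close>, of \<open>u v g\<close>, and of
  \<open>u v g^2\<close> respectively.\<close>

lemma has_sum_divisor_sums:
  fixes Q :: "'a::{field,finite} poly" and a y s :: complex
  assumes Q: "Q \<noteq> 0" and chi: "dirichlet_char Q chi" and y: "norm y \<le> 1"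
    and s: "Re s > 1" "Re (s - a) > 1" "Re (s - 2 * a) > 1" "Re (2 * s - 2 * a) > 1"
  shows "((\<lambda>f. y ^ big_Omega f / of_nat (pabs f) powr s *
      ((\<Sum>d | d dvd f \<and> monic d. chi d * of_nat (pabs d) powr a) *
       (\<Sum>d | d dvd f \<and> monic d. cnj (chi d) * of_nat (pabs d) powr a))) has_sum
    (zeta_A TYPE('a) s y * L_fun (s - 2 * a) (principal_char Q) y
       / L_fun (2 * s - 2 * a) (principal_char Q) (y ^ 2)) *
    (L_fun (s - a) chi y * L_fun (s - a) (\<lambda>f. cnj (chi f)) y)) {f. monic f}"
proof -
  define g where "g = (\<lambda>f :: 'a poly. y ^ big_Omega f / of_nat (pabs f) powr s)"
  define u where "u = (\<lambda>f. chi f * of_nat (pabs f) powr a)"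
  define v where "v = (\<lambda>f. cnj (chi f) * of_nat (pabs f) powr a)"
  let ?T = "\<lambda>z chi y f. y ^ big_Omega f * chi f * of_nat (pabs f) powr (-z)"
  have y2: "norm (y ^ 2) \<le> 1" using y by (simp add: norm_power power_le_one)
  have p: "complex_of_nat (pabs f) \<noteq> 0" for f :: "'a poly" using pabs_pos[of f] by simp
  note cnj = dirichlet_char_cnj[OF chi] and principal = dirichlet_char_principal[of Q]
  note char = dirichlet_char_one dirichlet_char_mult dirichlet_char_norm_le[OF Q]
  have eqs: "g = ?T s (\<lambda>_. 1) y" "(\<lambda>f. u f * g f) = ?T (s - a) chi y"
    "(\<lambda>f. v f * g f) = ?T (s - a) (\<lambda>f. cnj (chi f)) y"
    by (simp_all add: g_def u_def v_def powr_minus powr_diff divide_inverse mult_ac)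
  have powr_double: "w powr (2 * z) = w powr z * w powr z" for w z :: complex
    by (simp only: mult_2 powr_add)
  \<comment> \<open>A character times its conjugate is principal and the exponents add up to
    \<open>2 * a\<close>; this is the source of the shift by \<open>2 * a\<close> in two of the
    \<open>L_fun\<close> factors.\<close>
  have uv: "u f * v f = principal_char Q f * of_nat (pabs f) powr (2 * a)" for f
    unfolding u_def v_def dirichlet_char_mult_cnj[OF Q chi, symmetric] powr_double
    by (simp add: mult_ac)
  have eqs': "(\<lambda>f. u f * v f * g f) = ?T (s - 2 * a) (principal_char Q) y"
    "(\<lambda>f. u f * v f * g f ^ 2) = ?T (2 * s - 2 * a) (principal_char Q) (y ^ 2)"
    unfolding uv g_def minus_diff_eq powr_diff powr_double
    by (simp_all add: divide_inverse power2_eq_square power_mult_distrib mult_ac)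
  have twist: "summable_completely_multiplicative (?T z psi w)"
    "infsum (?T z psi w) {f. monic f} = L_fun z psi w"
    if "psi 1 = 1" "\<And>f g. psi (f * g) = psi f * psi g" "\<And>f. norm (psi f) \<le> 1"
      "norm w \<le> 1" "Re z > 1" for psi :: "'a poly \<Rightarrow> complex" and z w
    using summable_completely_multiplicative_twist[OF that] L_fun_eq_infsum[OF that] by simp_all
  have g: "summable_completely_multiplicative g" "infsum g {f. monic f} = zeta_A TYPE('a) s y"
    unfolding eqs(1) zeta_A_eq_L_fun by (rule twist; use s y in simp)+
  note u = twist[OF char(1,2,3)[OF chi] y s(2), folded eqs(2)]
  note v = twist[OF char(1,2,3)[OF cnj] y s(2), folded eqs(3)]
  note uv1 = twist[OF char(1,2,3)[OF principal] y s(3), folded eqs'(1)]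
  note uv2 = twist[OF char(1,2,3)[OF principal] y2 s(4), folded eqs'(2)]
  have "u (f * h) = u f * u h" "v (f * h) = v f * v h" if "monic f" "monic h" for f h
  proof -
    have "f \<noteq> 0" "h \<noteq> 0" using that by auto
    then show "u (f * h) = u f * u h" "v (f * h) = v f * v h"
      by (simp_all add: u_def v_def pabs_powr_mult dirichlet_char_mult[OF chi] mult_ac)
  qed
  from ramanujan_identity[OF g(1) u(1) v(1) uv1(1) uv2(1) this]
  show ?thesis
    unfolding g(2) u(2) v(2) uv1(2) uv2(2) unfolding g_def u_def v_def .
qed

lemma has_sum_sum_swap:
  fixes f :: "'i \<Rightarrow> 'b \<Rightarrow> complex"
  assumes "finite I" "\<And>i. i \<in> I \<Longrightarrow> (f i has_sum S i) A"
  shows "((\<lambda>x. \<Sum>i\<in>I. f i x) has_sum (\<Sum>i\<in>I. S i)) A"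
  using assms by (induction I rule: finite_induct) (auto intro: has_sum_add)

theorem theorem5p3:
  fixes Q :: "'a::{field,finite} poly" and a y s :: complex
  assumes "Q \<noteq> 0"
    and "norm y \<le> 1"
    and "Min {Re s, Re (s - a), Re (s - 2 * a), Re (2 * s - 2 * a)} > 1"
  shows "((\<lambda>f. y ^ big_Omega f / of_nat (pabs f) powr s * variance_sigma a f Q) has_sum
           (1 / of_nat (Phi Q) ^ 2 *
            (zeta_A TYPE('a) s y * L_fun (s - 2 * a) (principal_char Q) y
               / L_fun (2 * s - 2 * a) (principal_char Q) (y ^ 2)) *
            (\<Sum>chi | dirichlet_char Q chi \<and> chi \<noteq> principal_char Q.
               L_fun (s - a) chi y * L_fun (s - a) (\<lambda>f. cnj (chi f)) y)))
         {f. monic f}"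
proof -
  let ?N = "{chi. dirichlet_char Q chi \<and> chi \<noteq> principal_char Q}"
  let ?\<sigma> = "\<lambda>f chi. \<Sum>d | d dvd f \<and> monic d. chi d * of_nat (pabs d) powr a"
  let ?g = "\<lambda>f :: 'a poly. y ^ big_Omega f / of_nat (pabs f) powr s"
  let ?c = "1 / of_nat (Phi Q) ^ 2 :: complex"
  let ?K = "zeta_A TYPE('a) s y * L_fun (s - 2 * a) (principal_char Q) y
    / L_fun (2 * s - 2 * a) (principal_char Q) (y ^ 2)"
  have s: "Re s > 1" "Re (s - a) > 1" "Re (s - 2 * a) > 1" "Re (2 * s - 2 * a) > 1"
    using assms(3) by simp_all
  \<comment> \<open>There are finitely many characters, so the series can be added termwise; the
    factor \<open>?K\<close> does not depend on \<open>chi\<close> and is pulled out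
    afterwards.\<close>
  have "((\<lambda>f. \<Sum>chi\<in>?N. ?g f * (?\<sigma> f chi * ?\<sigma> f (\<lambda>d. cnj (chi d)))) has_sum
      (\<Sum>chi\<in>?N. ?K * (L_fun (s - a) chi y * L_fun (s - a) (\<lambda>f. cnj (chi f)) y))) {f. monic f}"
  proof (rule has_sum_sum_swap)
    show "finite ?N"
      by (rule finite_subset[OF _ finite_dirichlet_chars[OF assms(1)]]) auto
  qed (use has_sum_divisor_sums[OF assms(1) _ assms(2) s] in simp)
  then have "((\<lambda>f. ?c * (\<Sum>chi\<in>?N. ?g f * (?\<sigma> f chi * ?\<sigma> f (\<lambda>d. cnj (chi d))))) has_sum
      ?c * (\<Sum>chi\<in>?N. ?K * (L_fun (s - a) chi y * L_fun (s - a) (\<lambda>f. cnj (chi f)) y))) {f. monic f}"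
    by (rule has_sum_cmult_right)
  also have "?c * (\<Sum>chi\<in>?N. ?K * (L_fun (s - a) chi y * L_fun (s - a) (\<lambda>f. cnj (chi f)) y))
      = ?c * ?K * (\<Sum>chi\<in>?N. L_fun (s - a) chi y * L_fun (s - a) (\<lambda>f. cnj (chi f)) y)"
    by (simp only: sum_distrib_left mult.assoc)
  finally show ?thesis
  proof (rule has_sum_cong[THEN iffD1, rotated])
    fix f :: "'a poly" assume "f \<in> {f. monic f}"
    then have "f \<noteq> 0" by auto
    then show "?c * (\<Sum>chi\<in>?N. ?g f * (?\<sigma> f chi * ?\<sigma> f (\<lambda>d. cnj (chi d))))
        = ?g f * variance_sigma a f Q"
      unfolding variance_sigma_eq[OF assms(1) \<open>f \<noteq> 0\<close>] sum_distrib_left[symmetric] by simp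
  qed
qed

end
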